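(* Let $I=(S,\{t\},(\infty,\infty,\infty),0)$ be a convex instance of FLaMECaST (one intermediate layer, a single sink $t$, unlimited capacities, $\alpha=0$), and let $L$ be a layout of $I$. Then there is a layout $L^*$ of $I$ with $\mathrm{cost}(L^* )\le\mathrm{cost}(L)$ that is $3$-consecutive with respect to any cyclic ordering of the sources.
   Context: FLaMECaST: an instance $I=(S,T,C,\alpha)$ consists of a finite set $S$ of sources and a finite set $T$ of sinks, each with a fixed position in $\mathbb{R}^2$ (several sources may share a position), capacities $C=(c_0,\dots,c_{\lambda+1})$ ($\lambda$ = number of intermediate layers; here $\lambda=1$ and all capacities are $\infty$, i.e., no capacity constraints), and $\alpha\in[0,1]$. A layout consists of a rooted forest (edges directed from child to parent) of height at most $\lambda+1$ whose leaves are exactly $S$ and whose roots lie in $T$ (other vertices are Steiner vertices), together with an embedding mapping sources and sinks to their positions and Steiner vertices to arbitrary points of $\mathbb{R}^2$. The cost of an edge $uv$ ($u$ child of $v$) is $\|\mathrm{pos}(u)-\mathrm{pos}(v)\|\cdot\ell(uv)^\alpha$, where $\ell(uv)$ is the number of sources in the subtree of $u$; for $\alpha=0$ this is the edge length. The cost of a layout is the sum of its edge costs. An instance is convex if all sources lie on the boundary of the convex hull of $S\cup T$; a cyclic ordering of the sources is a counterclockwise order along this boundary (co-located sources ordered arbitrarily). A Steiner vertex is $k$-consecutive with respect to a cyclic ordering if its children can be partitioned into at most $k$ sequences of sources that are consecutive in that cyclic ordering; a layout is $k$-consecutive if all its Steiner vertices are. *)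

theory Defs
  imports "HOL-Complex_Analysis.Complex_Analysis" "HOL-Library.Extended_Nat" "HOL-Library.Disjoint_Sets"
begin

text \<open>
  The list \<open>capacities\<close> is $(c_0,\dots,c_{\lambda+1})$; its length determines the number
  $\lambda$ of intermediate layers. Positions are attached to the elements of \<open>sources\<close>, so
  several sources may share a position.
\<close>

record ('s, 't) flamecast =
  sources :: "'s set"
  sinks :: "'t set"
  source_pos :: "'s \<Rightarrow> real ^ 2"
  sink_pos :: "'t \<Rightarrow> real ^ 2"
  capacities :: "enat list"
  alpha :: real

definition is_instance :: "('s, 't) flamecast \<Rightarrow> bool" where
  "is_instance I \<longleftrightarrow>
     finite (sources I) \<and> finite (sinks I) \<and> 2 \<le> length (capacities I) \<and>
     0 \<le> alpha I \<and> alpha I \<le> 1"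

definition num_layers :: "('s, 't) flamecast \<Rightarrow> nat" where
  "num_layers I = length (capacities I) - 2"


datatype ('s, 't) vertex = Source 's | Sink 't | Steiner nat

text \<open>An edge \<open>(u, v)\<close> is directed from the child \<open>u\<close> to its parent \<open>v\<close>.\<close>

record ('s, 't) layout =
  verts :: "('s, 't) vertex set"
  edges :: "(('s, 't) vertex \<times> ('s, 't) vertex) set"
  pos :: "('s, 't) vertex \<Rightarrow> real ^ 2"

definition rooted_forest :: "('s, 't) layout \<Rightarrow> bool" where
  "rooted_forest L \<longleftrightarrow>
     finite (verts L) \<and> edges L \<subseteq> verts L \<times> verts L \<and>
     single_valued (edges L) \<and> acyclic (edges L)"

definition children :: "('s, 't) layout \<Rightarrow> ('s, 't) vertex \<Rightarrow> ('s, 't) vertex set" where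
  "children L v = {u. (u, v) \<in> edges L}"

definition leaves :: "('s, 't) layout \<Rightarrow> ('s, 't) vertex set" where
  "leaves L = {v \<in> verts L. children L v = {}}"

definition roots :: "('s, 't) layout \<Rightarrow> ('s, 't) vertex set" where
  "roots L = {v \<in> verts L. \<forall>w. (v, w) \<notin> edges L}"

definition vertex_height :: "('s, 't) layout \<Rightarrow> ('s, 't) vertex \<Rightarrow> nat" where
  "vertex_height L v = (GREATEST n. \<exists>u. (u, v) \<in> edges L ^^ n)"

definition load :: "('s, 't) layout \<Rightarrow> ('s, 't) vertex \<Rightarrow> nat" where
  "load L u = card {s. Source s \<in> verts L \<and> (Source s, u) \<in> (edges L)\<^sup>*}"

text \<open>
  Height at most $\lambda+1$ says that there is no directed path with $\lambda+2$ edges.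
  The capacity $c_i$ bounds the number of sources below a vertex of height $i$; this
  condition is vacuous when all capacities are infinite.
\<close>

definition is_layout :: "('s, 't) flamecast \<Rightarrow> ('s, 't) layout \<Rightarrow> bool" where
  "is_layout I L \<longleftrightarrow>
     rooted_forest L \<and>
     edges L ^^ (num_layers I + 2) = {} \<and>
     leaves L = Source ` sources I \<and>
     roots L \<subseteq> Sink ` sinks I \<and>
     verts L - leaves L - roots L \<subseteq> range Steiner \<and>
     (\<forall>v \<in> verts L. enat (load L v) \<le> capacities I ! vertex_height L v) \<and>
     (\<forall>s \<in> sources I. pos L (Source s) = source_pos I s) \<and>
     (\<forall>t \<in> sinks I. pos L (Sink t) = sink_pos I t)"

text \<open>
  In a layout every vertex has a leaf, hence a source, in its subtree. So all loads are
  positive, and for \<open>alpha I = 0\<close> the factor is 1 although \<open>0 powr 0 = 0\<close>.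
\<close>

definition cost :: "('s, 't) flamecast \<Rightarrow> ('s, 't) layout \<Rightarrow> real" where
  "cost I L = (\<Sum>(u, v) \<in> edges L. dist (pos L u) (pos L v) * real (load L u) powr alpha I)"


definition instance_hull :: "('s, 't) flamecast \<Rightarrow> (real ^ 2) set" where
  "instance_hull I = convex hull (source_pos I ` sources I \<union> sink_pos I ` sinks I)"

definition convex_instance :: "('s, 't) flamecast \<Rightarrow> bool" where
  "convex_instance I \<longleftrightarrow> source_pos I ` sources I \<subseteq> frontier (instance_hull I)"

definition to_complex :: "real ^ 2 \<Rightarrow> complex" where
  "to_complex p = Complex (p $ 1) (p $ 2)"

text \<open>
  A closed walk along the boundary of a compact convex set \<open>K\<close> in counterclockwise direction.
  If \<open>K\<close> has interior points, this is a simple closed curve with winding number 1 around them.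
  Otherwise \<open>K\<close> is a (possibly one-point) segment which is its own boundary, and the
  counterclockwise walk around it runs along the segment and back again.
\<close>

definition ccw_boundary_walk :: "(real \<Rightarrow> real ^ 2) \<Rightarrow> (real ^ 2) set \<Rightarrow> bool" where
  "ccw_boundary_walk g K \<longleftrightarrow>
     (if interior K \<noteq> {}
      then simple_path g \<and> pathfinish g = pathstart g \<and> path_image g = frontier K \<and>
           (\<forall>z \<in> interior K. winding_number (to_complex \<circ> g) (to_complex z) = 1)
      else \<exists>a b. K = closed_segment a b \<and> g = linepath a b +++ linepath b a)"

text \<open>
  A cyclic ordering is represented by a list, read cyclically, of the sources in the order of
  their times along a counterclockwise boundary walk. Times may coincide, so co-located sources
  can appear in any order.
\<close>

definition cyclic_ordering :: "('s, 't) flamecast \<Rightarrow> 's list \<Rightarrow> bool" where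
  "cyclic_ordering I xs \<longleftrightarrow>
     distinct xs \<and> set xs = sources I \<and>
     (\<exists>g ts. ccw_boundary_walk g (instance_hull I) \<and>
        sorted ts \<and> set ts \<subseteq> {0..1} \<and> map g ts = map (source_pos I) xs)"

definition consecutive_in :: "'s list \<Rightarrow> 's set \<Rightarrow> bool" where
  "consecutive_in xs A \<longleftrightarrow> (\<exists>n m. A = set (take m (rotate n xs)))"

definition k_consecutive_vertex ::
    "nat \<Rightarrow> 's list \<Rightarrow> ('s, 't) layout \<Rightarrow> ('s, 't) vertex \<Rightarrow> bool" where
  "k_consecutive_vertex k xs L v \<longleftrightarrow>
     (\<exists>P. partition_on (children L v) P \<and> finite P \<and> card P \<le> k \<and>
        (\<forall>B \<in> P. \<exists>A. B = Source ` A \<and> consecutive_in xs A))"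

definition k_consecutive :: "nat \<Rightarrow> 's list \<Rightarrow> ('s, 't) layout \<Rightarrow> bool" where
  "k_consecutive k xs L \<longleftrightarrow>
     (\<forall>v \<in> verts L \<inter> range Steiner. k_consecutive_vertex k xs L v)"

end

theory Submission
  imports Defs "HOL-Library.Sublist"
begin

text \<open>
  Project the Steiner vertices of \<open>L\<close> onto the convex hull \<open>K\<close> and connect every source to
  its nearest site, a site being a Steiner vertex or the sink. This does not increase the cost.
  Ties are broken by a small generic perturbation of the sites (into the interior of \<open>K\<close>, if
  there is one), which is used for the assignment only.

  Suppose the Voronoi cell of the site \<open>q = 0\<close> is not 3-consecutive. Then there are boundary
  points in cyclic order \<open>s\<^sub>1, r\<^sub>1, \<dots>, s\<^sub>4, r\<^sub>4\<close> with the \<open>s\<^sub>i\<close> in the cell and the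
  \<open>r\<^sub>i\<close> outside. Shooting rays from \<open>0\<close> through the sites of the \<open>r\<^sub>i\<close> replaces these by
  boundary points \<open>e\<^sub>i\<close> on the same arcs that are farther from every \<open>s\<^sub>j\<close> than \<open>0\<close> is.
  Four directions around \<open>0\<close> cannot have all consecutive angles obtuse, so some \<open>s\<close> lies in a
  cone spanned by consecutive \<open>e, e'\<close> with \<open>e \<bullet> e' \<ge> 0\<close>. Writing
  \<open>s = \<alpha> e + \<beta> e'\<close>, the distance conditions give \<open>\<alpha>, \<beta> < 1/2\<close>, so \<open>s\<close> is an
  interior point of \<open>K\<close>, a contradiction. If \<open>K\<close> is a segment, convexity of the cell suffices.
\<close>

subsection \<open>Cyclic runs in lists\<close>

fun alternating :: "'a set \<Rightarrow> bool \<Rightarrow> 'a list \<Rightarrow> bool" where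
  "alternating A b [] \<longleftrightarrow> True"
| "alternating A b (x # xs) \<longleftrightarrow> (x \<in> A) = b \<and> alternating A (\<not> b) xs"

lemma alternating_append:
  "alternating A b (xs @ ys) \<longleftrightarrow>
     alternating A b xs \<and> alternating A (if even (length xs) then b else \<not> b) ys"
  by (induction xs arbitrary: b) auto

lemma subseq_Cons_skip:
  assumes "subseq (z # zs) (y # ys)" "z \<noteq> y"
  shows "subseq (z # zs) ys"
  using assms by (auto elim: list_emb.cases)

text \<open>Induction on \<open>k\<close>: cut \<open>ys\<close> into leading non-members
  \<open>us\<close>, the first maximal run \<open>vs\<close> and the rest \<open>ws\<close>. Either
  \<open>vs\<close> is one more block beside those of \<open>ws\<close>, or an alternating sequence
  in \<open>ws\<close> is extended by two entries.\<close>

lemma linear_runs_or_alternating: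
  assumes "distinct ys"
  shows "(\<exists>P. partition_on (A \<inter> set ys) P \<and> finite P \<and> card P \<le> k \<and>
            (\<forall>B\<in>P. \<exists>us vs ws. ys = us @ vs @ ws \<and> B = set vs)) \<or>
         (\<exists>zs. subseq zs ys \<and> length zs = 2 * k + 1 \<and> alternating A True zs)"
  using assms
proof (induction k arbitrary: ys)
  case 0
  show ?case
  proof (cases "A \<inter> set ys = {}")
    case True
    then show ?thesis by (intro disjI1 exI[of _ "{}"]) (auto simp: partition_on_def)
  next
    case False
    then obtain x where "x \<in> A" "x \<in> set ys" by auto
    then show ?thesis by (intro disjI2 exI[of _ "[x]"]) (auto simp: subseq_singleton_left)
  qed
next
  case (Suc k)
  define us where "us = takeWhile (\<lambda>x. x \<notin> A) ys"
  define ys' where "ys' = dropWhile (\<lambda>x. x \<notin> A) ys"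
  define vs where "vs = takeWhile (\<lambda>x. x \<in> A) ys'"
  define ws where "ws = dropWhile (\<lambda>x. x \<in> A) ys'"
  have ys: "ys = us @ vs @ ws"
    by (simp add: us_def ys'_def vs_def ws_def)
  have us: "set us \<inter> A = {}" by (auto simp: us_def dest: set_takeWhileD)
  have vs: "set vs \<subseteq> A" by (auto simp: vs_def dest: set_takeWhileD)
  have d: "distinct ws" "set us \<inter> set ws = {}" "set vs \<inter> set ws = {}"
    using Suc.prems by (auto simp: ys)
  show ?case
  proof (cases "vs = []")
    case True
    have "ys' = []"
    proof (rule ccontr)
      assume "ys' \<noteq> []"
      moreover from this have "hd ys' \<in> A"
        using hd_dropWhile[of "\<lambda>x. x \<notin> A" ys] by (auto simp: ys'_def)
      ultimately show False using True by (cases ys') (auto simp: vs_def)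
    qed
    then have "A \<inter> set ys = {}" using us by (auto simp: ys vs_def ws_def)
    then show ?thesis by (intro disjI1 exI[of _ "{}"]) (auto simp: partition_on_def)
  next
    case vs0: False
    show ?thesis
      using Suc.IH[OF d(1)]
    proof (elim disjE exE conjE)
      fix P assume P: "partition_on (A \<inter> set ws) P" "finite P" "card P \<le> k"
        "\<forall>B\<in>P. \<exists>us vs ws'. ws = us @ vs @ ws' \<and> B = set vs"
      have eq: "A \<inter> set ys = set vs \<union> (A \<inter> set ws)" using us vs by (auto simp: ys)
      have "partition_on (A \<inter> set ys) (insert (set vs) P)"
        unfolding eq using P(1) vs0 d(3)
        by (auto simp: partition_on_def disjoint_def)
      moreover have "\<exists>us' vs' ws'. ys = us' @ vs' @ ws' \<and> B = set vs'" if "B \<in> P" for B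
      proof -
        obtain a b c where "ws = a @ b @ c" "B = set b" using P(4) \<open>B \<in> P\<close> by metis
        then show ?thesis by (intro exI[of _ "us @ vs @ a"] exI[of _ b] exI[of _ c]) (simp add: ys)
      qed
      ultimately show ?thesis
        using P(2,3) ys by (intro disjI1 exI[of _ "insert (set vs) P"])
          (auto simp: card_insert_if)
    next
      fix zs assume zs: "subseq zs ws" "length zs = 2 * k + 1" "alternating A True zs"
      obtain z zs' where z: "zs = z # zs'" using zs(2) by (cases zs) auto
      have "ws \<noteq> []" using zs(1) z by auto
      then obtain w ws' where w: "ws = w # ws'" by (cases ws) auto
      have "w \<notin> A" using hd_dropWhile[of "\<lambda>x. x \<in> A" ys'] w unfolding ws_def
        by (metis list.sel(1) list.discI)
      moreover have "z \<in> A" using zs(3) z by auto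
      \<comment> \<open>\<open>zs\<close> starts with a member and \<open>ws\<close> with the
        non-member \<open>w\<close>, so \<open>zs\<close> embeds behind \<open>w\<close>, which can
        then separate it from \<open>v\<close>.\<close>
      ultimately have sub: "subseq zs ws'" using subseq_Cons_skip zs(1) z w by metis
      obtain v vs' where v: "vs = v # vs'" using vs0 by (cases vs) auto
      have "subseq (v # w # zs) ys"
        using sub by (auto simp: ys v w intro!: subseq_drop_many list_emb_append2)
      moreover have "v \<in> A" using vs v by auto
      ultimately show ?thesis using zs \<open>w \<notin> A\<close>
        by (intro disjI2 exI[of _ "v # w # zs"]) auto
    qed
  qed
qed

text \<open>Rotating the list so that it starts with a non-member \<open>y\<close> makes every
  cyclic run linear. An alternating sequence of length \<open>2 * k + 1\<close> in the rotated list
  gains the entry \<open>y\<close> and is then carried back to the original order.\<close>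

lemma cyclic_runs_or_alternating:
  assumes "distinct xs" "A \<subseteq> set xs" "1 \<le> k"
  shows "(\<exists>P. partition_on A P \<and> finite P \<and> card P \<le> k \<and> (\<forall>B\<in>P. consecutive_in xs B)) \<or>
         (\<exists>zs b. subseq zs xs \<and> length zs = 2 * k + 2 \<and> alternating A b zs)"
proof (cases "A = set xs")
  case True
  show ?thesis
  proof (cases "A = {}")
    case True
    then show ?thesis by (intro disjI1 exI[of _ "{}"]) (auto simp: partition_on_def)
  next
    case False
    have "consecutive_in xs A"
      unfolding consecutive_in_def using True
      by (intro exI[of _ 0] exI[of _ "length xs"]) auto
    then show ?thesis using False assms(3)
      by (intro disjI1 exI[of _ "{A}"]) (auto simp: partition_on_def)
  qed
next
  case False
  define us where "us = takeWhile (\<lambda>x. x \<in> A) xs"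
  define ys where "ys = dropWhile (\<lambda>x. x \<in> A) xs"
  have xs: "xs = us @ ys" by (simp add: us_def ys_def)
  have us: "set us \<subseteq> A" by (auto simp: us_def dest: set_takeWhileD)
  have "ys \<noteq> []" using False us assms(2) xs by auto
  then obtain y ys' where y: "ys = y # ys'" by (cases ys) auto
  have yA: "y \<notin> A" using hd_dropWhile[of "\<lambda>x. x \<in> A" xs] y unfolding ys_def by (metis list.sel(1) list.discI)
  have rot: "ys @ us = rotate (length us) xs" by (simp add: xs rotate_append)
  have "A \<inter> set (ys @ us) = A" using assms(2) xs by auto
  moreover have "distinct (ys @ us)" using assms(1) xs by auto
  ultimately consider
      P where "partition_on A P" "finite P" "card P \<le> k"
        "\<forall>B\<in>P. \<exists>a b c. ys @ us = a @ b @ c \<and> B = set b"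
    | zs where "subseq zs (ys @ us)" "length zs = 2 * k + 1" "alternating A True zs"
    using linear_runs_or_alternating[of "ys @ us" A k] by metis
  then show ?thesis
  proof cases
    case 1
    have "consecutive_in xs B" if "B \<in> P" for B
    proof -
      obtain a b c where abc: "ys @ us = a @ b @ c" "B = set b" using 1(4) \<open>B \<in> P\<close> by metis
      have "rotate (length a + length us) xs = b @ c @ a"
        unfolding rotate_rotate[symmetric] rot[symmetric] abc(1) rotate_append by simp
      then show ?thesis unfolding consecutive_in_def
        by (intro exI[of _ "length a + length us"] exI[of _ "length b"]) (simp add: abc)
    qed
    then show ?thesis using 1 by blast
  next
    case 2
    obtain z1 z2 where z: "zs = z1 @ z2" "subseq z1 ys" "subseq z2 us"
      using 2(1) by (auto simp: subseq_append_iff)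
    have z2A: "set z2 \<subseteq> A"
    proof
      fix x assume "x \<in> set z2"
      then obtain y where "y \<in> set us" "x = y" using list_emb_set[OF z(3)] by metis
      then show "x \<in> A" using us by auto
    qed
    have skip: "subseq (y # z1) ys" if "z1 = [] \<or> hd z1 \<in> A"
    proof (cases z1)
      case Nil
      then show ?thesis by (simp add: y)
    next
      case (Cons a list)
      then show ?thesis using that z(2) yA subseq_Cons_skip[of a list y ys'] by (auto simp: y split: if_splits)
    qed
    have h: "z1 = [] \<or> hd z1 \<in> A" using 2(3) z(1) by (cases z1) auto
    \<comment> \<open>The prefix \<open>us\<close> that was moved to the end consists of members
      only, so at most the last entry of an alternating sequence lies there. In the original order
      this entry comes before \<open>y\<close>.\<close>
    show ?thesis
    proof (cases z2)
      case Nil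
      have "subseq (y # zs) xs" using skip[OF h] z(1) Nil by (simp add: xs subseq_drop_many)
      then show ?thesis using 2 yA by (intro disjI2 exI[of _ "y # zs"] exI[of _ False]) auto
    next
      case (Cons a z3)
      have "z3 = []"
        using 2(3) z2A unfolding z(1) Cons alternating_append
        by (cases z3) (auto split: if_splits)
      then have z2: "z2 = [a]" using Cons by simp
      have "subseq ([a] @ (y # z1)) (us @ ys)"
        using z(3) skip[OF h] z2 list_emb_append_mono by blast
      moreover have "alternating A True z1" using 2(3) z(1) by (simp add: alternating_append)
      ultimately show ?thesis using 2(2) z(1) z2 z2A yA
        by (intro disjI2 exI[of _ "a # y # z1"] exI[of _ True]) (auto simp: xs)
    qed
  qed
qed

subsection \<open>Separation of boundary arcs by rays\<close>

definition cross :: "real ^ 2 \<Rightarrow> real ^ 2 \<Rightarrow> real" where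
  "cross a b = a $ 1 * b $ 2 - a $ 2 * b $ 1"

definition ray :: "real ^ 2 \<Rightarrow> (real ^ 2) set" where
  "ray a = {c *\<^sub>R a |c. 0 \<le> c}"

definition open_cone :: "real ^ 2 \<Rightarrow> real ^ 2 \<Rightarrow> (real ^ 2) set" where
  "open_cone a b = {\<alpha> *\<^sub>R a + \<beta> *\<^sub>R b |\<alpha> \<beta>. 0 < \<alpha> \<and> 0 < \<beta>}"

lemma cross_simps:
  "cross a (x + y) = cross a x + cross a y" "cross (x + y) a = cross x a + cross y a"
  "cross a (c *\<^sub>R x) = c * cross a x" "cross (c *\<^sub>R x) a = c * cross x a"
  "cross a a = 0" "cross a (- x) = - cross a x" "cross (- x) a = - cross x a"
  by (simp_all add: cross_def algebra_simps)

lemma cross_commute: "cross a b = - cross b a"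
  by (simp add: cross_def)

lemma continuous_on_cross [continuous_intros]:
  assumes "continuous_on S f" "continuous_on S g"
  shows "continuous_on S (\<lambda>x. cross (f x) (g x))"
  unfolding cross_def using assms by (intro continuous_intros)

text \<open>Cramer's rule for the basis \<open>a\<close>, \<open>b\<close>.\<close>

lemma cross_expand:
  assumes "cross a b \<noteq> 0"
  shows "z = (cross z b / cross a b) *\<^sub>R a + (cross a z / cross a b) *\<^sub>R b"
proof -
  have "cross a b *\<^sub>R z = cross z b *\<^sub>R a + cross a z *\<^sub>R b"
    by (simp add: vec_eq_iff forall_2 cross_def algebra_simps)
  then have "inverse (cross a b) *\<^sub>R (cross a b *\<^sub>R z) =
      inverse (cross a b) *\<^sub>R (cross z b *\<^sub>R a + cross a z *\<^sub>R b)" by (rule arg_cong)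
  then show ?thesis using assms by (simp add: scaleR_add_right divide_inverse mult.commute)
qed

lemma cross_zero_parallel:
  assumes "cross a b = 0" "a \<noteq> 0"
  obtains k where "b = k *\<^sub>R a"
proof -
  have "(a \<bullet> a) *\<^sub>R b = (a \<bullet> b) *\<^sub>R a"
    using assms(1)
    by (simp add: vec_eq_iff forall_2 cross_def inner_vec_def sum_2) (algebra)
  then have "inverse (a \<bullet> a) *\<^sub>R ((a \<bullet> a) *\<^sub>R b) = inverse (a \<bullet> a) *\<^sub>R ((a \<bullet> b) *\<^sub>R a)"
    by (rule arg_cong)
  then have "b = ((a \<bullet> b) / (a \<bullet> a)) *\<^sub>R a" using assms(2) by (simp add: divide_inverse mult.commute)
  then show ?thesis using that by blast
qed

lemma open_cone_iff:
  assumes "cross a b \<noteq> 0"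
  shows "z \<in> open_cone a b \<longleftrightarrow> 0 < cross z b / cross a b \<and> 0 < cross a z / cross a b"
proof
  assume "z \<in> open_cone a b"
  then obtain \<alpha> \<beta> where "z = \<alpha> *\<^sub>R a + \<beta> *\<^sub>R b" "0 < \<alpha>" "0 < \<beta>" by (auto simp: open_cone_def)
  then show "0 < cross z b / cross a b \<and> 0 < cross a z / cross a b"
    using assms by (simp add: cross_simps)
next
  assume "0 < cross z b / cross a b \<and> 0 < cross a z / cross a b"
  then show "z \<in> open_cone a b" using cross_expand[OF assms, of z] unfolding open_cone_def by blast
qed

text \<open>In the coordinates \<open>f\<close>, \<open>h\<close> with respect to non-parallel
  \<open>a\<close>, \<open>b\<close>, both are positive on \<open>U\<close> and at least one is
  negative on \<open>V\<close>. For opposite rays the halves are open half-planes. Closure under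
  positive scaling later allows points to be moved radially to the boundary.\<close>

lemma ray_complement_halves:
  assumes "a \<noteq> 0" "b \<noteq> 0" "b \<notin> ray a"
  obtains U V where "open U" "open V" "U \<inter> V = {}" "U \<union> V = - (ray a \<union> ray b)"
    "U \<noteq> {}" "V \<noteq> {}" "\<And>x c. x \<in> U \<Longrightarrow> 0 < c \<Longrightarrow> c *\<^sub>R x \<in> U"
    "\<And>x c. x \<in> V \<Longrightarrow> 0 < c \<Longrightarrow> c *\<^sub>R x \<in> V"
    "cross a b \<noteq> 0 \<Longrightarrow> U = open_cone a b"
proof (cases "cross a b = 0")
  case False
  let ?D = "cross a b"
  define f where "f z = cross z b / ?D" for z
  define h where "h z = cross a z / ?D" for z
  note fh = f_def h_def
  have expand: "z = f z *\<^sub>R a + h z *\<^sub>R b" for z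
    using cross_expand[OF False, of z] by (simp add: fh)
  define U where "U = {z. 0 < f z} \<inter> {z. 0 < h z}"
  define V where "V = {z. f z < 0} \<union> {z. h z < 0}"
  have U: "U = open_cone a b" using open_cone_iff[OF False] by (auto simp: U_def fh)
  have cont: "continuous_on UNIV f" "continuous_on UNIV h"
    unfolding fh using False by (auto intro!: continuous_intros)
  have "z \<in> U \<union> V \<longleftrightarrow> z \<notin> ray a \<union> ray b" for z
  proof -
    have "z \<in> ray a \<longleftrightarrow> 0 \<le> f z \<and> h z = 0"
    proof
      assume "z \<in> ray a"
      then show "0 \<le> f z \<and> h z = 0" using False by (auto simp: ray_def cross_simps fh)
    next
      assume "0 \<le> f z \<and> h z = 0"
      then show "z \<in> ray a" using expand[of z] unfolding ray_def by (auto intro!: exI[of _ "f z"])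
    qed
    moreover have "z \<in> ray b \<longleftrightarrow> 0 \<le> h z \<and> f z = 0"
    proof
      assume "z \<in> ray b"
      then show "0 \<le> h z \<and> f z = 0" using False by (auto simp: ray_def cross_simps fh)
    next
      assume "0 \<le> h z \<and> f z = 0"
      then show "z \<in> ray b" using expand[of z] unfolding ray_def by (auto intro!: exI[of _ "h z"])
    qed
    ultimately show ?thesis unfolding U_def V_def by (auto simp: not_less less_le)
  qed
  moreover have "a + b \<in> U" using False by (simp add: U_def cross_simps fh)
  moreover have "- a \<in> V" using False by (simp add: V_def cross_simps fh)
  moreover have "c *\<^sub>R x \<in> U" if "x \<in> U" "0 < c" for c x
    using that by (auto simp add: U_def cross_simps zero_less_mult_iff zero_less_divide_iff mult_less_0_iff fh)
  moreover have "c *\<^sub>R x \<in> V" if "x \<in> V" "0 < c" for c x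
    using that by (auto simp add: V_def cross_simps mult_less_0_iff divide_less_0_iff zero_less_mult_iff fh)
  moreover have "open U" "open V"
    unfolding U_def V_def using cont by (auto intro!: open_Int open_Un open_Collect_less continuous_intros)
  moreover have "U \<inter> V = {}" by (auto simp: U_def V_def)
  ultimately show ?thesis using that[of U V] U by blast
next
  case True
  then obtain k where k: "b = k *\<^sub>R a" using cross_zero_parallel assms(1) by blast
  have "\<not> 0 \<le> k" using assms(3) k unfolding ray_def by blast
  then have "k < 0" by simp
  define U where "U = {z. 0 < cross a z}"
  define V where "V = {z. cross a z < 0}"
  have "z \<in> ray a \<union> ray b \<longleftrightarrow> cross a z = 0" for z
  proof
    assume "z \<in> ray a \<union> ray b"
    then show "cross a z = 0" by (auto simp: ray_def cross_simps k)
  next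
    assume "cross a z = 0"
    then obtain l where l: "z = l *\<^sub>R a" using cross_zero_parallel assms(1) by blast
    show "z \<in> ray a \<union> ray b"
    proof (cases "0 \<le> l")
      case True
      then show ?thesis using l by (auto simp: ray_def)
    next
      case False
      then have "z = (l / k) *\<^sub>R b" "0 \<le> l / k" using l k \<open>k < 0\<close> by (auto simp: divide_nonpos_neg)
      then show ?thesis unfolding ray_def by blast
    qed
  qed
  then have "U \<union> V = - (ray a \<union> ray b)" unfolding U_def V_def by force
  \<comment> \<open>\<open>w\<close> is \<open>a\<close> turned by a right angle;
    \<open>cross a w\<close> is the squared length of \<open>a\<close>, so \<open>w\<close> and
    \<open>- w\<close> lie in the two half-planes.\<close>
  moreover define w :: "real ^ 2" where "w = vector [- a $ 2, a $ 1]"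
  have "cross a w = a $ 1 * a $ 1 + a $ 2 * a $ 2" by (simp add: cross_def w_def)
  moreover have "a $ 1 \<noteq> 0 \<or> a $ 2 \<noteq> 0" using assms(1) by (auto simp: vec_eq_iff forall_2)
  ultimately have "0 < cross a w" using sum_squares_gt_zero_iff[of "a $ 1" "a $ 2"] by simp
  then have "w \<in> U" "- w \<in> V" by (auto simp: U_def V_def cross_simps)
  moreover have "c *\<^sub>R x \<in> U" if "x \<in> U" "0 < c" for c x
    using that by (simp add: U_def cross_simps)
  moreover have "c *\<^sub>R x \<in> V" if "x \<in> V" "0 < c" for c x
    using that by (auto simp add: V_def cross_simps mult_less_0_iff)
  moreover have "open U" "open V"
    unfolding U_def V_def by (auto intro!: open_Collect_less continuous_intros)
  moreover have "U \<inter> V = {}" by (auto simp: U_def V_def)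
  ultimately show ?thesis using that[of U V] True \<open>U \<union> V = _\<close> by blast
qed

section \<open>Boundary loops around an interior point\<close>

lemma interior_shrink_0:
  fixes K :: "(real ^ 2) set"
  assumes "convex K" "0 \<in> interior K" "x \<in> K" "0 \<le> c" "c < 1"
  shows "c *\<^sub>R x \<in> interior K"
  using mem_interior_convex_shrink[OF assms(1-3), of "1 - c"] assms(4,5)
  by (simp add: algebra_simps)

text \<open>A point of \<open>K\<close> scaled towards the interior point \<open>0\<close> becomes
  interior, so of two frontier points on one ray neither is a proper shrinking of the other.\<close>

lemma frontier_ray_unique:
  fixes K :: "(real ^ 2) set"
  assumes K: "convex K" "closed K" "0 \<in> interior K" and "a \<in> frontier K" "b \<in> frontier K" "b \<in> ray a"
  shows "b = a"
proof -
  have ab: "a \<in> K" "b \<in> K" "a \<notin> interior K" "b \<notin> interior K"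
    using assms by (auto simp: frontier_def)
  obtain c where c: "b = c *\<^sub>R a" "0 \<le> c" using assms(6) by (auto simp: ray_def)
  have "\<not> c < 1" using interior_shrink_0[OF K(1,3) ab(1)] c ab(4) by metis
  moreover have "\<not> 1 < c"
  proof
    assume "1 < c"
    then have "a = (1 / c) *\<^sub>R b" using c by simp
    then show False using interior_shrink_0[OF K(1,3) ab(2), of "1/c"] \<open>1 < c\<close> ab(3) by auto
  qed
  ultimately show ?thesis using c by auto
qed

text \<open>
  Times \<open>u\<close> and \<open>v\<close> cut a loop into two arcs; this selects the arc that does not pass
  through time \<open>0\<close>, whichever of \<open>u\<close>, \<open>v\<close> comes first.
\<close>

definition in_arc :: "real \<Rightarrow> real \<Rightarrow> real \<Rightarrow> bool" where
  "in_arc u v w \<longleftrightarrow> min u v < w \<and> w < max u v"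

text \<open>The origin stands for the site whose cell is studied. On the times from \<open>0\<close>
  up to but excluding \<open>1\<close> the loop is injective and still covers the frontier.\<close>

locale convex_loop =
  fixes K :: "(real ^ 2) set" and g :: "real \<Rightarrow> real ^ 2"
  assumes convex: "convex K" and compact: "compact K" and zero_interior: "0 \<in> interior K"
    and simple: "simple_path g" and loop: "g 1 = g 0" and image: "g ` {0..1} = frontier K"
begin

lemma closed: "closed K" using compact by (rule compact_imp_closed)

lemma g_frontier: "0 \<le> u \<Longrightarrow> u < 1 \<Longrightarrow> g u \<in> frontier K"
  using image by (metis atLeastAtMost_iff imageI less_imp_le)

lemma g_in: "0 \<le> u \<Longrightarrow> u < 1 \<Longrightarrow> g u \<in> K"
  using g_frontier closed frontier_subset_closed by blast

lemma g_not_interior: "0 \<le> u \<Longrightarrow> u < 1 \<Longrightarrow> g u \<notin> interior K"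
  using g_frontier by (auto simp: frontier_def)

lemma g_nonzero: "0 \<le> u \<Longrightarrow> u < 1 \<Longrightarrow> g u \<noteq> 0"
  using g_not_interior zero_interior by metis

lemma g_inj: "0 \<le> u \<Longrightarrow> u < 1 \<Longrightarrow> 0 \<le> v \<Longrightarrow> v < 1 \<Longrightarrow> g u = g v \<Longrightarrow> u = v"
  using simple unfolding simple_path_def loop_free_def by force

lemma g_ray:
  assumes "0 \<le> u" "u < 1" "0 \<le> v" "v < 1" "u \<noteq> v"
  shows "g v \<notin> ray (g u)"
  using frontier_ray_unique[OF convex closed zero_interior g_frontier g_frontier, of u v] g_inj assms
  by metis

lemma frontier_time:
  assumes "x \<in> frontier K"
  obtains u where "0 \<le> u" "u < 1" "x = g u"
proof -
  obtain u where "0 \<le> u" "u \<le> 1" "x = g u" using assms image by fastforce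
  then show ?thesis using that loop by (cases "u = 1") force+
qed

lemma continuous_g: "continuous_on {0..1} g"
  using simple by (simp add: simple_path_def path_def)

text \<open>Both arcs are connected and miss both rays, so each lies in \<open>U\<close> or in
  \<open>V\<close>. Together they meet \<open>U\<close> as well as \<open>V\<close>, hence they lie
  in different halves.\<close>

lemma arcs_separated_ordered:
  assumes uv: "0 \<le> u" "u < v" "v < 1"
    and UV: "open U" "open V" "U \<inter> V = {}" "U \<union> V = - (ray (g u) \<union> ray (g v))"
    and ne: "U \<noteq> {}" "V \<noteq> {}"
    and scale: "\<And>x c. x \<in> U \<Longrightarrow> 0 < c \<Longrightarrow> c *\<^sub>R x \<in> U" "\<And>x c. x \<in> V \<Longrightarrow> 0 < c \<Longrightarrow> c *\<^sub>R x \<in> V"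
    and w: "u < w" "w < v" and w': "0 \<le> w'" "w' < 1" "w' < u \<or> v < w'"
  shows "g w \<in> U \<longleftrightarrow> g w' \<in> V"
proof -
  define A where "A = g ` {u<..<v}"
  define B where "B = g ` ({0..<u} \<union> {v<..<1})"
  have A: "connected A" unfolding A_def
    using uv by (intro connected_continuous_image continuous_on_subset[OF continuous_g]) auto
  have B: "connected B"
  proof (cases "u = 0")
    case True
    then show ?thesis unfolding B_def using uv
      by (intro connected_continuous_image continuous_on_subset[OF continuous_g]) auto
  next
    case False
    \<comment> \<open>Since \<open>g 1 = g 0\<close>, time \<open>1\<close> may be added to the
      second piece; the two pieces of the outer arc then share the point \<open>g 0\<close>.\<close>
    have "B = g ` {0..<u} \<union> g ` {v<..1}"
    proof -
      have "{v<..1} = insert 1 {v<..<1}" using uv by auto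
      moreover have "g 1 \<in> g ` {0..<u}" using loop False uv by auto
      ultimately show ?thesis unfolding B_def by auto
    qed
    moreover have "connected (g ` {0..<u} \<union> g ` {v<..1})"
    proof (rule connected_Un)
      show "connected (g ` {0..<u})" "connected (g ` {v<..1})"
        using uv by (auto intro!: connected_continuous_image continuous_on_subset[OF continuous_g])
      have "g 0 \<in> g ` {0..<u}" "g 1 \<in> g ` {v<..1}" using False uv by auto
      then show "g ` {0..<u} \<inter> g ` {v<..1} \<noteq> {}" using loop by auto
    qed
    ultimately show ?thesis by simp
  qed
  have AB: "A \<subseteq> U \<union> V" "B \<subseteq> U \<union> V"
    unfolding UV(4) A_def B_def using uv g_ray[of u] g_ray[of v] by auto
  \<comment> \<open>A point of a half can be scaled onto the frontier without leaving the half, and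
    the time at which the loop visits it is neither \<open>u\<close> nor \<open>v\<close>.\<close>
  have cover: "\<exists>x\<in>A \<union> B. x \<in> X"
    if X: "X \<noteq> {}" "\<And>x c. x \<in> X \<Longrightarrow> 0 < c \<Longrightarrow> c *\<^sub>R x \<in> X" "X \<subseteq> U \<union> V" for X
  proof -
    obtain x where x: "x \<in> X" using X(1) by auto
    have zr: "0 \<in> ray (g u)" by (auto simp: ray_def intro!: exI[of _ 0])
    have "x \<noteq> 0" using X(3) x UV(4) zr by auto
    then obtain d where d: "0 < d" "0 + d *\<^sub>R x \<in> frontier K"
      using ray_to_frontier[OF compact_imp_bounded[OF compact] zero_interior] by metis
    then obtain \<tau> where \<tau>: "0 \<le> \<tau>" "\<tau> < 1" "d *\<^sub>R x = g \<tau>" using frontier_time by auto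
    have dx: "d *\<^sub>R x \<in> X" using X(2) x d by auto
    have "g z \<in> ray (g z)" for z by (auto simp: ray_def intro!: exI[of _ 1])
    then have "\<tau> \<noteq> u" "\<tau> \<noteq> v" using dx X(3) \<tau>(3) UV(4) by auto
    then have "g \<tau> \<in> A \<union> B" unfolding A_def B_def using \<tau> uv by force
    then show ?thesis using dx \<tau> by metis
  qed
  have "U \<inter> A = {} \<or> V \<inter> A = {}" "U \<inter> B = {} \<or> V \<inter> B = {}"
    using connectedD[OF A UV(1,2)] connectedD[OF B UV(1,2)] UV(3) AB by auto
  moreover have "\<exists>x\<in>A \<union> B. x \<in> U" "\<exists>x\<in>A \<union> B. x \<in> V"
    using cover[of U] cover[of V] ne scale by auto
  moreover have "g w \<in> A" "g w' \<in> B" using w w' by (auto simp: A_def B_def)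
  ultimately show ?thesis using AB UV(3) by blast
qed

text \<open>The ordered case is applied to either order of \<open>u\<close> and \<open>v\<close>,
  and to either choice of which of \<open>w\<close>, \<open>w'\<close> lies between them.\<close>

lemma arcs_separated:
  assumes "0 \<le> u" "u < 1" "0 \<le> v" "v < 1" "0 \<le> w" "w < 1" "0 \<le> w'" "w' < 1"
    and "u \<noteq> v" "w \<notin> {u, v}" "w' \<notin> {u, v}" "in_arc u v w \<noteq> in_arc u v w'"
  obtains U V where "open U" "open V" "U \<inter> V = {}" "U \<union> V = - (ray (g u) \<union> ray (g v))"
    "g w \<in> U \<longleftrightarrow> g w' \<in> V" "cross (g u) (g v) \<noteq> 0 \<Longrightarrow> U = open_cone (g u) (g v)"
proof -
  obtain U V where UV: "open U" "open V" "U \<inter> V = {}" "U \<union> V = - (ray (g u) \<union> ray (g v))"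
    "U \<noteq> {}" "V \<noteq> {}" "\<And>x c. x \<in> U \<Longrightarrow> 0 < c \<Longrightarrow> c *\<^sub>R x \<in> U"
    "\<And>x c. x \<in> V \<Longrightarrow> 0 < c \<Longrightarrow> c *\<^sub>R x \<in> V"
    "cross (g u) (g v) \<noteq> 0 \<Longrightarrow> U = open_cone (g u) (g v)"
    by (rule ray_complement_halves[of "g u" "g v"]) (use g_nonzero g_ray assms in \<open>auto\<close>)
  have eq: "U \<union> V = - (ray (g v) \<union> ray (g u))" using UV(4) by auto
  have in_UV: "g z \<in> U \<union> V" if "0 \<le> z" "z < 1" "z \<notin> {u, v}" for z
    using g_ray[of u z] g_ray[of v z] assms that UV(4) by auto
  have main: "g x \<in> U \<longleftrightarrow> g y \<in> V"
    if "in_arc u v x" "\<not> in_arc u v y" "0 \<le> y" "y < 1" "y \<notin> {u, v}" for x y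
  proof (cases "u < v")
    case True
    show ?thesis
      by (rule arcs_separated_ordered[OF _ True _ UV(1-8)]) (use assms(1-4) that True in \<open>auto simp: in_arc_def\<close>)
  next
    case False
    then have "v < u" using assms by auto
    show ?thesis
      by (rule arcs_separated_ordered[OF _ \<open>v < u\<close> _ UV(1-3) eq UV(5-8)])
        (use assms(1-4) that \<open>v < u\<close> in \<open>auto simp: in_arc_def\<close>)
  qed
  have "g w \<in> U \<longleftrightarrow> g w' \<in> V"
  proof (cases "in_arc u v w")
    case True
    then show ?thesis using main[of w w'] assms by blast
  next
    case False
    then have "g w' \<in> U \<longleftrightarrow> g w \<in> V" using main[of w' w] assms by blast
    then show ?thesis using in_UV[of w] in_UV[of w'] assms UV(3) by blast
  qed
  from that[OF UV(1-4) this UV(9)] show ?thesis .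
qed

text \<open>For non-parallel rays the open cone is one of the two halves, so it contains exactly one
  of the two open arcs.\<close>

lemma cone_exclusive:
  assumes "0 \<le> u" "u < 1" "0 \<le> v" "v < 1" "0 \<le> w" "w < 1" "0 \<le> w'" "w' < 1"
    and "u \<noteq> v" "w \<notin> {u, v}" "w' \<notin> {u, v}" "in_arc u v w \<noteq> in_arc u v w'"
    and "cross (g u) (g v) \<noteq> 0"
  shows "g w \<in> open_cone (g u) (g v) \<longleftrightarrow> g w' \<notin> open_cone (g u) (g v)"
proof -
  obtain U V where UV: "U \<inter> V = {}" "U \<union> V = - (ray (g u) \<union> ray (g v))"
    "g w \<in> U \<longleftrightarrow> g w' \<in> V" "U = open_cone (g u) (g v)"
    by (rule arcs_separated[OF assms(1-12)]) (use assms(13) in blast)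
  have "g w' \<in> U \<union> V" using g_ray[of u w'] g_ray[of v w'] assms UV(2) by auto
  then show ?thesis using UV by blast
qed

text \<open>The segment from \<open>g w\<close> to \<open>g w'\<close> stays in \<open>K\<close> and
  in the half-plane. Inside \<open>K\<close> it could meet the ray of \<open>g u\<close> only at
  \<open>c *\<^sub>R g u\<close> with \<open>c \<le> 1\<close>, which is on the wrong side of the
  line; likewise for \<open>g v\<close>. So it stays in one half of the complement of the
  rays.\<close>

lemma halfplane_same_arc:
  assumes "0 \<le> u" "u < 1" "0 \<le> v" "v < 1" "0 \<le> w" "w < 1" "0 \<le> w'" "w' < 1"
    and "u \<noteq> v" and h: "0 \<le> h" "g u \<bullet> p < h" "g v \<bullet> p < h" "h < g w \<bullet> p" "h < g w' \<bullet> p"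
  shows "in_arc u v w \<longleftrightarrow> in_arc u v w'"
proof (rule ccontr)
  assume nb: "in_arc u v w \<noteq> in_arc u v w'"
  have ne: "w \<notin> {u, v}" "w' \<notin> {u, v}" using h by auto
  obtain U V where UV: "open U" "open V" "U \<inter> V = {}" "U \<union> V = - (ray (g u) \<union> ray (g v))"
    "g w \<in> U \<longleftrightarrow> g w' \<in> V"
    using arcs_separated[OF assms(1-9) ne nb] by metis
  let ?S = "closed_segment (g w) (g w')"
  have SK: "?S \<subseteq> K" using closed_segment_subset[OF g_in g_in convex] assms by auto
  have "convex {x. h < x \<bullet> p}" using convex_halfspace_gt[of h p] by (simp add: inner_commute)
  then have Sh: "?S \<subseteq> {x. h < x \<bullet> p}" using closed_segment_subset[of "g w" _ "g w'"] h by auto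
  have avoid: "x \<notin> ray (g z)" if x: "x \<in> ?S" and z: "0 \<le> z" "z < 1" "g z \<bullet> p < h" for x z
  proof
    assume "x \<in> ray (g z)"
    then obtain c where c: "x = c *\<^sub>R g z" "0 \<le> c" by (auto simp: ray_def)
    have hx: "h < c * (g z \<bullet> p)" using Sh x c by auto
    have "c \<le> 1"
    proof (rule ccontr)
      assume "\<not> c \<le> 1"
      then have "g z = (1 / c) *\<^sub>R x" using c by simp
      then show False
        using interior_shrink_0[OF convex zero_interior, of x "1/c"] \<open>\<not> c \<le> 1\<close> g_not_interior[OF z(1,2)] SK x
        by auto
    qed
    moreover have "0 < g z \<bullet> p" using hx h(1) mult_nonneg_nonpos[OF c(2), of "g z \<bullet> p"] by linarith
    ultimately have "c * (g z \<bullet> p) \<le> g z \<bullet> p" by (simp add: mult_left_le_one_le c(2))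
    then show False using hx z(3) by linarith
  qed
  have sub: "?S \<subseteq> U \<union> V" unfolding UV(4) using avoid assms h by blast
  have "U \<inter> ?S = {} \<or> V \<inter> ?S = {}"
    using connectedD[OF _ UV(1,2) _ sub] UV(3) by auto
  moreover have "g w \<in> ?S" "g w' \<in> ?S" by auto
  ultimately show False using sub UV(3,5) by blast
qed

end

subsection \<open>Voronoi cells on a convex boundary\<close>

text \<open>The bisector of \<open>0\<close> and \<open>p\<close> is the line
  \<open>x \<bullet> p = (p \<bullet> p) / 2\<close>, as the term \<open>s \<bullet> s\<close>
  cancels from the squared distances.\<close>

lemma inner_lt_half_if_closer:
  fixes s p :: "'a::real_inner"
  assumes "norm s < dist s p"
  shows "s \<bullet> p < (p \<bullet> p) / 2"
proof -
  have "(norm s)\<^sup>2 < (norm (s - p))\<^sup>2" using assms by (simp add: dist_norm power_strict_mono)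
  then show ?thesis by (simp add: power2_norm_eq_inner inner_diff_left inner_diff_right inner_commute)
qed

lemma inner_gt_half_if_farther:
  fixes s p :: "'a::real_inner"
  assumes "dist s p < norm s"
  shows "(p \<bullet> p) / 2 < s \<bullet> p"
proof -
  have "(norm (s - p))\<^sup>2 < (norm s)\<^sup>2" using assms by (simp add: dist_norm power_strict_mono)
  then show ?thesis by (simp add: power2_norm_eq_inner inner_diff_left inner_diff_right inner_commute)
qed

context convex_loop
begin

text \<open>Acuteness makes the mixed term nonnegative, so each distance condition bounds one
  coefficient of \<open>s\<close> by \<open>1/2\<close>. Hence \<open>s\<close> is a convex
  combination of \<open>e\<close> and \<open>e'\<close> shrunk by the factor
  \<open>\<alpha> + \<beta> < 1\<close>.\<close>

lemma acute_cone_interior: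
  assumes e: "e \<in> K" "e' \<in> K" "0 \<le> e \<bullet> e'" and s: "s \<in> open_cone e e'"
    and closer: "s \<bullet> e < (e \<bullet> e) / 2" "s \<bullet> e' < (e' \<bullet> e') / 2"
  shows "s \<in> interior K"
proof -
  obtain \<alpha> \<beta> where ab: "s = \<alpha> *\<^sub>R e + \<beta> *\<^sub>R e'" "0 < \<alpha>" "0 < \<beta>"
    using s by (auto simp: open_cone_def)
  have half: "c < 1/2" if "c * (x \<bullet> x) + d * (x \<bullet> y) < (x \<bullet> x) / 2" "0 < d" "0 \<le> x \<bullet> y"
    for c d :: real and x y :: "real ^ 2"
  proof (rule ccontr)
    assume "\<not> c < 1/2"
    then have "(x \<bullet> x) / 2 \<le> c * (x \<bullet> x)" using mult_right_mono[of "1/2" c "x \<bullet> x"] by simp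
    moreover have "0 \<le> d * (x \<bullet> y)" using that by simp
    ultimately show False using that(1) by linarith
  qed
  have "\<alpha> < 1/2" "\<beta> < 1/2"
    using half[of \<alpha> e \<beta> e'] half[of \<beta> e' \<alpha> e] closer ab e(3)
    by (auto simp: inner_add_left inner_commute algebra_simps)
  define c where "c = \<alpha> + \<beta>"
  have c: "0 < c" "c < 1" using ab \<open>\<alpha> < 1/2\<close> \<open>\<beta> < 1/2\<close> by (auto simp: c_def)
  have "(\<alpha> / c) *\<^sub>R e + (\<beta> / c) *\<^sub>R e' \<in> K"
    using convex e ab c by (intro convexD) (auto simp: c_def add_divide_distrib[symmetric])
  from interior_shrink_0[OF convex zero_interior this, of c] show ?thesis
    using c ab by (simp add: scaleR_add_right)
qed

text \<open>The loop meets each ray only once, so parallel \<open>g u\<close> and \<open>g v\<close>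
  would point in opposite directions and have a negative inner product.\<close>

lemma cross_nonzero_if_acute:
  assumes "0 \<le> u" "u < 1" "0 \<le> v" "v < 1" "u \<noteq> v" "0 \<le> g u \<bullet> g v"
  shows "cross (g u) (g v) \<noteq> 0"
proof
  assume "cross (g u) (g v) = 0"
  then obtain k where k: "g v = k *\<^sub>R g u" using cross_zero_parallel g_nonzero assms by metis
  have "k < 0" using g_ray[of u v] assms k unfolding ray_def by force
  then have "k * (g u \<bullet> g u) < 0" using g_nonzero[of u] assms by (simp add: mult_neg_pos)
  then show False using assms(6) k by simp
qed

text \<open>
  If \<open>g s\<close> is not in the acute cone of \<open>g a\<close> and \<open>g b\<close>, then this cone contains
  everything on the complementary arc, in particular \<open>g c\<close>. So \<open>g b\<close> and \<open>g c\<close> also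
  span an acute cone, and that one does contain \<open>g s'\<close>.
\<close>

lemma acute_step_impossible:
  assumes unit: "0 \<le> a" "a < 1" "0 \<le> b" "b < 1" "0 \<le> c" "c < 1" "0 \<le> s" "s < 1" "0 \<le> s'" "s' < 1"
    and dist: "distinct [a, b, c, s, s']"
    and ord: "in_arc a b s \<noteq> in_arc a b c" "in_arc b c s' \<noteq> in_arc b c a"
    and acute: "0 \<le> g a \<bullet> g b"
    and closer: "\<And>x y. x \<in> {s, s'} \<Longrightarrow> y \<in> {a, b, c} \<Longrightarrow> g x \<bullet> g y < (g y \<bullet> g y) / 2"
  shows False
proof -
  have ab: "cross (g a) (g b) \<noteq> 0" using cross_nonzero_if_acute[OF unit(1-4)] dist acute by auto
  show False
  proof (cases "g s \<in> open_cone (g a) (g b)")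
    case True
    then have "g s \<in> interior K"
      using acute_cone_interior[OF g_in g_in acute True] unit closer by auto
    then show False using g_not_interior unit by auto
  next
    case False
    then have "g c \<in> open_cone (g a) (g b)"
      using cone_exclusive[of a b s c] unit dist ord(1) ab by auto
    then obtain \<alpha> \<beta> where c: "g c = \<alpha> *\<^sub>R g a + \<beta> *\<^sub>R g b" "0 < \<alpha>" "0 < \<beta>"
      by (auto simp: open_cone_def)
    have acute': "0 \<le> g b \<bullet> g c"
      using c acute by (simp add: inner_add_right inner_commute)
    have bc: "cross (g b) (g c) \<noteq> 0"
      using cross_nonzero_if_acute[OF unit(3-6)] dist acute' by auto
    \<comment> \<open>\<open>g c\<close> lies between \<open>g a\<close> and \<open>g b\<close>, so
      \<open>g a\<close> cannot lie between \<open>g b\<close> and \<open>g c\<close>: comparing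
      determinants would force \<open>\<beta> + \<gamma> * \<alpha> = 0\<close> although both terms
      are positive.\<close>
    have "g a \<notin> open_cone (g b) (g c)"
    proof
      assume "g a \<in> open_cone (g b) (g c)"
      then obtain \<gamma> \<delta> where "g a = \<gamma> *\<^sub>R g b + \<delta> *\<^sub>R g c" "0 < \<gamma>" "0 < \<delta>"
        by (auto simp: open_cone_def)
      then have "cross (g a) (g c) = \<gamma> * cross (g b) (g c)" by (simp add: cross_simps)
      moreover have "cross (g a) (g c) = \<beta> * cross (g a) (g b)"
        "cross (g b) (g c) = - \<alpha> * cross (g a) (g b)"
        using c cross_commute[of "g b" "g a"] by (simp_all add: cross_simps)
      ultimately have "(\<beta> + \<gamma> * \<alpha>) * cross (g a) (g b) = 0" by (simp add: algebra_simps)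
      then show False using ab c(2,3) \<open>0 < \<gamma>\<close> by (simp add: add_pos_pos less_imp_neq[symmetric])
    qed
    then have s': "g s' \<in> open_cone (g b) (g c)"
      using cone_exclusive[of b c s' a] unit dist ord(2) bc by auto
    then have "g s' \<in> interior K"
      using acute_cone_interior[OF g_in g_in acute' s'] unit closer by auto
    then show False using g_not_interior unit by auto
  qed
qed

text \<open>By \<open>acute_step_impossible\<close> all four consecutive angles are obtuse. But
  \<open>g e2\<close> and \<open>g e4\<close> lie on different arcs between \<open>g e1\<close> and
  \<open>g e3\<close>, so one of them is in the cone these span, and no vector in the cone is obtuse
  to both generators. If the generators are opposite, \<open>g e2\<close> already gives the
  contradiction. The arc of \<open>e4\<close> passes through time \<open>0\<close>, hence the
  disjunction for it.\<close>

lemma no_alternating_frontier_points: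
  assumes s: "0 \<le> s1" "s1 < s2" "s2 < s3" "s3 < s4" "s4 < 1"
    and e: "s1 < e1" "e1 < s2" "s2 < e2" "e2 < s3" "s3 < e3" "e3 < s4"
      "0 \<le> e4" "e4 < 1" "e4 < s1 \<or> s4 < e4"
    and closer: "\<And>x y. x \<in> {s1, s2, s3, s4} \<Longrightarrow> y \<in> {e1, e2, e3, e4} \<Longrightarrow> g x \<bullet> g y < (g y \<bullet> g y) / 2"
  shows False
proof -
  have c: "\<forall>x\<in>{s1, s2, s3, s4}. \<forall>y\<in>{e1, e2, e3, e4}. g x \<bullet> g y < (g y \<bullet> g y) / 2"
    using closer by blast
  have 1: "g e1 \<bullet> g e2 < 0"
    by (rule ccontr, rule acute_step_impossible[of e1 e2 e3 s2 s3])
      (use s e c in \<open>auto simp: in_arc_def\<close>)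
  have 2: "g e2 \<bullet> g e3 < 0"
    by (rule ccontr, rule acute_step_impossible[of e2 e3 e4 s3 s4])
      (use s e c in \<open>auto simp: in_arc_def\<close>)
  have 3: "g e3 \<bullet> g e4 < 0"
    by (rule ccontr, rule acute_step_impossible[of e3 e4 e1 s4 s1])
      (use s e c in \<open>auto simp: in_arc_def\<close>)
  have 4: "g e4 \<bullet> g e1 < 0"
    by (rule ccontr, rule acute_step_impossible[of e4 e1 e2 s1 s2])
      (use s e c in \<open>auto simp: in_arc_def\<close>)
  have obtuse: "g y \<notin> open_cone (g e1) (g e3)" if "g e1 \<bullet> g y < 0" "g e3 \<bullet> g y < 0" for y
  proof
    assume "g y \<in> open_cone (g e1) (g e3)"
    then obtain \<alpha> \<beta> where y: "g y = \<alpha> *\<^sub>R g e1 + \<beta> *\<^sub>R g e3" "0 < \<alpha>" "0 < \<beta>"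
      by (auto simp: open_cone_def)
    then have "g y \<bullet> g y = \<alpha> * (g e1 \<bullet> g y) + \<beta> * (g e3 \<bullet> g y)"
      by (metis inner_add_left inner_scaleR_left)
    moreover have "\<alpha> * (g e1 \<bullet> g y) < 0" "\<beta> * (g e3 \<bullet> g y) < 0"
      using y that by (auto simp: mult_pos_neg)
    ultimately show False using inner_ge_zero[of "g y"] by linarith
  qed
  show False
  proof (cases "cross (g e1) (g e3) = 0")
    case True
    moreover have "g e1 \<noteq> 0" using g_nonzero[of e1] s e by auto
    ultimately obtain k where k: "g e3 = k *\<^sub>R g e1" using cross_zero_parallel by blast
    have "g e3 \<notin> ray (g e1)" using s e by (intro g_ray) auto
    then have "\<not> 0 \<le> k" using k unfolding ray_def by auto
    then have "0 < k * (g e2 \<bullet> g e1)" using 1 by (simp add: inner_commute mult_neg_neg)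
    then show False using 2 k by simp
  next
    case False
    have "g e2 \<in> open_cone (g e1) (g e3) \<longleftrightarrow> g e4 \<notin> open_cone (g e1) (g e3)"
      by (rule cone_exclusive) (use s e False in \<open>auto simp: in_arc_def\<close>)
    then show False using obtuse[of e2] obtuse[of e4] 1 2 3 4 by (auto simp: inner_commute)
  qed
qed

text \<open>Each outside point is nearer to some site than to \<open>0\<close>. It is exchanged for
  the frontier point in the direction of that site, which lies on the same arc, and
  \<open>no_alternating_frontier_points\<close> applies.\<close>

lemma no_alternating_cells:
  assumes s: "0 \<le> s1" "s1 < s2" "s2 < s3" "s3 < s4" "s4 < 1"
    and r: "s1 < r1" "r1 < s2" "s2 < r2" "r2 < s3" "s3 < r3" "r3 < s4" "s4 < r4" "r4 \<le> 1"
    and inside: "\<And>x p. x \<in> {s1, s2, s3, s4} \<Longrightarrow> p \<in> P \<Longrightarrow> norm (g x) < dist (g x) p"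
    and outside: "\<And>x. x \<in> {r1, r2, r3, r4} \<Longrightarrow> \<exists>p\<in>P. dist (g x) p < norm (g x)"
    and P: "P \<subseteq> K"
  shows False
proof -
  define S where "S = {s1, s2, s3, s4}"
  define good where "good r e \<longleftrightarrow> 0 \<le> e \<and> e < 1 \<and> (\<forall>x\<in>S. g x \<bullet> g e < (g e \<bullet> g e) / 2) \<and>
      (\<forall>u\<in>S. \<forall>v\<in>S. u \<noteq> v \<longrightarrow> in_arc u v e = in_arc u v r) \<and> e \<notin> S" for r e
  \<comment> \<open>A competing site may be pushed radially to the boundary: it stays closer to \<open>g r\<close> than \<open>0\<close>,
    and the part of the boundary closer to the site than \<open>0\<close> is a single arc.\<close>
  have shoot: "\<exists>e. good r e"
    if rr: "0 \<le> r" "r < 1" and ex: "\<exists>p\<in>P. dist (g r) p < norm (g r)" for r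
  proof -
    obtain p where p: "p \<in> P" "dist (g r) p < norm (g r)" using ex by blast
    have "p \<noteq> 0" using p(2) by auto
    then obtain d where d: "0 < d" "0 + d *\<^sub>R p \<in> frontier K"
      using ray_to_frontier[OF compact_imp_bounded[OF compact] zero_interior] by metis
    have "1 \<le> d"
    proof (rule ccontr)
      assume "\<not> 1 \<le> d"
      then have "d *\<^sub>R p \<in> interior K"
        using interior_shrink_0[OF convex zero_interior, of p d] p P d by auto
      then show False using d by (simp add: frontier_def)
    qed
    obtain e where e: "0 \<le> e" "e < 1" "d *\<^sub>R p = g e" using d frontier_time by auto
    have pp: "0 < p \<bullet> p" using \<open>p \<noteq> 0\<close> by simp
    have sp: "g x \<bullet> p < (p \<bullet> p) / 2" if "x \<in> S" for x
      using inner_lt_half_if_closer inside[OF _ p(1)] that unfolding S_def by blast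
    have rp: "(p \<bullet> p) / 2 < g r \<bullet> p" using inner_gt_half_if_farther p(2) by blast
    have ep: "(p \<bullet> p) / 2 < g e \<bullet> p"
    proof -
      have "1 * (p \<bullet> p) \<le> d * (p \<bullet> p)" using \<open>1 \<le> d\<close> pp by (intro mult_right_mono) auto
      then have "p \<bullet> p \<le> g e \<bullet> p" by (simp add: e(3)[symmetric])
      then show ?thesis using pp by linarith
    qed
    have unit: "0 \<le> x \<and> x < 1" if "x \<in> S" for x using that s by (auto simp: S_def)
    \<comment> \<open>Pushing the site outward by the factor \<open>d \<ge> 1\<close> moves its
      bisector with \<open>0\<close> away from \<open>0\<close>, so the points with times in
      \<open>S\<close> stay on the side of \<open>0\<close>.\<close>
    have "g x \<bullet> g e < (g e \<bullet> g e) / 2" if "x \<in> S" for x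
    proof -
      have "d * (g x \<bullet> p) < d * ((p \<bullet> p) / 2)" using sp[OF that] d(1) by (rule mult_strict_left_mono)
      also have "\<dots> \<le> d * (d * (p \<bullet> p)) / 2"
        using mult_right_mono[OF \<open>1 \<le> d\<close>, of "d * (p \<bullet> p)"] pp d(1) by simp
      finally show ?thesis by (simp add: e(3)[symmetric])
    qed
    moreover have "in_arc u v e = in_arc u v r"
      if "u \<in> S" "v \<in> S" "u \<noteq> v" for u v
      using halfplane_same_arc[of u v e r "(p \<bullet> p) / 2" p] unit[OF that(1)] unit[OF that(2)]
        that(3) e(1,2) rr pp sp[OF that(1)] sp[OF that(2)] rp ep by auto
    moreover have "e \<notin> S" using ep sp by force
    ultimately show ?thesis using e unfolding good_def by blast
  qed
  \<comment> \<open>Time \<open>1\<close> is replaced by \<open>0\<close>, the same point of the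
    loop. In that case \<open>s1 = 0\<close> is impossible, since \<open>g s1\<close> would be both
    inside and outside the cell.\<close>
  obtain r4' where r4': "0 \<le> r4'" "r4' < 1" "g r4' = g r4" "r4' < s1 \<or> s4 < r4'"
  proof (cases "r4 = 1")
    case True
    have "s1 \<noteq> 0"
    proof
      assume "s1 = 0"
      then have "g r4 = g s1" using True loop by simp
      then show False using outside[of r4] inside[of s1] by force
    qed
    then show ?thesis using that[of 0] True loop s by auto
  next
    case False
    then show ?thesis using that[of r4] s r by auto
  qed
  have "0 \<le> r1" "r1 < 1" "0 \<le> r2" "r2 < 1" "0 \<le> r3" "r3 < 1" using s r by auto
  then obtain e1 e2 e3 e4 where "good r1 e1" "good r2 e2" "good r3 e3" "good r4' e4"
    using shoot[of r1] shoot[of r2] shoot[of r3] shoot[of r4'] r4' outside by (metis insertCI)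
  then have e: "0 \<le> e4" "e4 < 1" "e4 \<noteq> s1" "e4 \<noteq> s4"
      "in_arc s1 s2 e1 = in_arc s1 s2 r1" "in_arc s2 s3 e2 = in_arc s2 s3 r2"
      "in_arc s3 s4 e3 = in_arc s3 s4 r3" "in_arc s1 s4 e4 = in_arc s1 s4 r4'"
    and closer: "\<And>x y. x \<in> S \<Longrightarrow> y \<in> {e1, e2, e3, e4} \<Longrightarrow> g x \<bullet> g y < (g y \<bullet> g y) / 2"
    using s unfolding good_def S_def by auto
  have "s1 < e1 \<and> e1 < s2" "s2 < e2 \<and> e2 < s3" "s3 < e3 \<and> e3 < s4"
    using e(5-7) s r by (auto simp: in_arc_def)
  moreover have "e4 < s1 \<or> s4 < e4" using e(3,4,8) r4'(4) s by (auto simp: in_arc_def)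
  ultimately show False
    using no_alternating_frontier_points[of s1 s2 s3 s4 e1 e2 e3 e4] closer s e(1,2)
    unfolding S_def by blast
qed

end

section \<open>Generic sites and Voronoi cells along a boundary walk\<close>

text \<open>A new point ties with an earlier one only on finitely many circles centred in
  \<open>X\<close>, a null set that cannot cover a nonempty open set.\<close>

lemma generic_points_exist:
  fixes X :: "(real ^ 2) set" and N :: "'z \<Rightarrow> (real ^ 2) set"
  assumes "finite Z" "finite X" "\<And>z. z \<in> Z \<Longrightarrow> open (N z)" "\<And>z. z \<in> Z \<Longrightarrow> N z \<noteq> {}"
  shows "\<exists>\<sigma>. (\<forall>z\<in>Z. \<sigma> z \<in> N z) \<and>
    (\<forall>z\<in>Z. \<forall>z'\<in>Z. \<forall>x\<in>X. z \<noteq> z' \<longrightarrow> dist x (\<sigma> z) \<noteq> dist x (\<sigma> z'))"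
  using assms(1,3,4)
proof (induction Z rule: finite_induct)
  case empty
  then show ?case by simp
next
  case (insert z Z)
  then obtain \<sigma> where \<sigma>: "\<forall>z\<in>Z. \<sigma> z \<in> N z"
    "\<forall>z\<in>Z. \<forall>z'\<in>Z. \<forall>x\<in>X. z \<noteq> z' \<longrightarrow> dist x (\<sigma> z) \<noteq> dist x (\<sigma> z')"
    by (metis insertCI)
  let ?B = "\<Union>((\<lambda>(x, y). sphere x (dist x (\<sigma> y))) ` (X \<times> Z))"
  have "negligible ?B"
    using insert.hyps(1) assms(2) by (intro negligible_Union) (auto simp: negligible_sphere)
  moreover have "\<not> negligible (N z)" using insert.prems open_not_negligible by auto
  ultimately have "\<not> N z \<subseteq> ?B" using negligible_subset by blast
  then obtain y where y: "y \<in> N z" "y \<notin> ?B" by blast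
  have "dist x y \<noteq> dist x (\<sigma> z')" if "x \<in> X" "z' \<in> Z" for x z'
    using y(2) that by (auto simp: sphere_def)
  then show ?case using \<sigma> y(1) insert.hyps(2)
    by (intro exI[of _ "\<sigma>(z := y)"]) (auto simp: metric_space_class.dist_commute, (metis)+)
qed

lemma closer_iff_inner:
  fixes x p q :: "'a::real_inner"
  shows "dist x q < dist x p \<longleftrightarrow> (2 *\<^sub>R (p - q)) \<bullet> x < p \<bullet> p - q \<bullet> q"
proof -
  have "dist x q < dist x p \<longleftrightarrow> (dist x q)\<^sup>2 < (dist x p)\<^sup>2"
    by (metis abs_of_nonneg zero_le_dist power2_less_imp_less power_strict_mono pos2)
  also have "\<dots> \<longleftrightarrow> (2 *\<^sub>R (p - q)) \<bullet> x < p \<bullet> p - q \<bullet> q"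
    by (simp add: dist_norm power2_norm_eq_inner inner_diff_left inner_diff_right inner_commute
        algebra_simps)
  finally show ?thesis .
qed

lemma convex_voronoi_cell:
  fixes q :: "'a::real_inner"
  shows "convex {x. \<forall>p\<in>Q. dist x q < dist x p}"
proof -
  have eq: "{x. \<forall>p\<in>Q. dist x q < dist x p} = (\<Inter>p\<in>Q. {x. (2 *\<^sub>R (p - q)) \<bullet> x < p \<bullet> p - q \<bullet> q})"
    unfolding closer_iff_inner by auto
  show ?thesis unfolding eq by (intro convex_INT convex_halfspace_lt)
qed

text \<open>Translation by \<open>- q\<close> moves the site to the origin of
  \<open>convex_loop\<close>. The times are strictly increasing because neighbouring ones differ in
  being inside or outside the cell.\<close>

lemma voronoi_cell_loop:
  fixes K :: "(real ^ 2) set"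
  assumes K: "convex K" "compact K" "q \<in> interior K" "Q \<subseteq> K"
    and g: "simple_path g" "pathfinish g = pathstart g" "path_image g = frontier K"
    and t: "0 \<le> t1" "t1 \<le> t2" "t2 \<le> t3" "t3 \<le> t4" "t4 \<le> t5" "t5 \<le> t6" "t6 \<le> t7" "t7 \<le> t8" "t8 \<le> 1"
    and inside: "\<And>x p. x \<in> {t1, t3, t5, t7} \<Longrightarrow> p \<in> Q \<Longrightarrow> dist (g x) q < dist (g x) p"
    and outside: "\<And>x. x \<in> {t2, t4, t6, t8} \<Longrightarrow> \<exists>p\<in>Q. dist (g x) p < dist (g x) q"
  shows False
proof -
  have neq: "x \<noteq> y" if "x \<in> {t1, t3, t5, t7}" "y \<in> {t2, t4, t6, t8}" for x y
    using inside[OF that(1)] outside[OF that(2)] by force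
  have lt: "t1 < t2" "t2 < t3" "t3 < t4" "t4 < t5" "t5 < t6" "t6 < t7" "t7 < t8"
    using neq[of t1 t2] neq[of t3 t2] neq[of t3 t4] neq[of t5 t4] neq[of t5 t6] neq[of t7 t6]
      neq[of t7 t8] t by simp_all
  let ?f = "(+) (- q)"
  interpret convex_loop "?f ` K" "?f \<circ> g"
  proof
    show "convex (?f ` K)" using K(1) by (rule convex_translation)
    show "compact (?f ` K)" using K(2) by (rule compact_translation)
    show "0 \<in> interior (?f ` K)" unfolding interior_translation using K(3) by force
    show "simple_path (?f \<circ> g)" using g(1) by (simp add: simple_path_translation_eq)
    show "(?f \<circ> g) 1 = (?f \<circ> g) 0" using g(2) by (simp add: pathstart_def pathfinish_def)
    show "(?f \<circ> g) ` {0..1} = frontier (?f ` K)"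
      unfolding frontier_translation image_comp[symmetric] using g(3) by (simp add: path_image_def)
  qed
  have n: "norm ((?f \<circ> g) x) = dist (g x) q" "dist ((?f \<circ> g) x) (?f p) = dist (g x) p" for x p
    by (simp_all add: dist_norm)
  show False
  proof (rule no_alternating_cells[of t1 t3 t5 t7 t2 t4 t6 t8 "?f ` Q"])
    show "norm ((?f \<circ> g) x) < dist ((?f \<circ> g) x) p" if "x \<in> {t1, t3, t5, t7}" "p \<in> ?f ` Q" for x p
      using that(2) inside[OF that(1)] n by auto
    show "\<exists>p\<in>?f ` Q. dist ((?f \<circ> g) x) p < norm ((?f \<circ> g) x)" if "x \<in> {t2, t4, t6, t8}" for x
      using outside[OF that] n by auto
    show "?f ` Q \<subseteq> ?f ` K" using K(4) by blast
  qed (use t lt in linarith)+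
qed

lemma linepath_in_segment:
  assumes "x \<le> y" "y \<le> z"
  shows "linepath a b y \<in> closed_segment (linepath a b x) (linepath a b z)"
proof (cases "x = z")
  case True
  then show ?thesis using assms by simp
next
  case False
  define c where "c = (y - x) / (z - x)"
  have "c * (z - x) = y - x" using False by (simp add: c_def)
  then have "y = (1 - c) * x + c * z" by (simp add: algebra_simps)
  moreover have "0 \<le> c" "c \<le> 1" using assms False by (auto simp: c_def divide_le_eq_1)
  ultimately have c: "0 \<le> c" "c \<le> 1" "y = (1 - c) * x + c * z" by auto
  have "linepath a b y = (1 - c) *\<^sub>R linepath a b x + c *\<^sub>R linepath a b z"
    unfolding linepath_def c(3) by (simp add: algebra_simps)
  then show ?thesis using c(1,2) by (auto simp: in_segment)
qed

text \<open>The walk turns at time \<open>1/2\<close>, and on either side of the turn it runs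
  straight.\<close>

lemma there_and_back_in_segment:
  assumes "x \<le> y" "y \<le> z" "z \<le> 1/2 \<or> 1/2 \<le> x"
  shows "(linepath a b +++ linepath b a) y \<in>
    closed_segment ((linepath a b +++ linepath b a) x) ((linepath a b +++ linepath b a) z)"
proof -
  let ?g = "linepath a b +++ linepath b a"
  have 1: "?g t = linepath a b (2 * t)" if "t \<le> 1/2" for t
    using that by (simp add: joinpaths_def)
  have 2: "?g t = linepath b a (2 * t - 1)" if "1/2 \<le> t" for t
  proof (cases "t = 1/2")
    case True
    then show ?thesis unfolding True by (simp add: joinpaths_def linepath_def)
  next
    case False
    then show ?thesis using that by (simp add: joinpaths_def)
  qed
  show ?thesis using assms(3)
  proof
    assume "z \<le> 1/2"
    then show ?thesis using linepath_in_segment[of "2 * x" "2 * y" "2 * z" a b] assms 1 by auto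
  next
    assume "1/2 \<le> x"
    then show ?thesis using linepath_in_segment[of "2 * x - 1" "2 * y - 1" "2 * z - 1" b a] assms 2 by auto
  qed
qed

text \<open>Four of the eight points are in the cell and four are not. If \<open>K\<close> has
  interior points, \<open>voronoi_cell_loop\<close> applies, after reversal if the first point is
  outside. On a segment, three points in, out and in on one leg contradict convexity of the
  cell.\<close>

lemma voronoi_cell_boundary_walk:
  fixes K :: "(real ^ 2) set"
  assumes K: "convex K" "compact K" and int: "interior K \<noteq> {} \<Longrightarrow> q \<in> interior K \<and> Q \<subseteq> K"
    and g: "ccw_boundary_walk g K"
    and ts: "sorted ts" "set ts \<subseteq> {0..1}" "length ts = 8"
    and alt: "alternating {x. \<forall>p\<in>Q. dist x q < dist x p} b (map g ts)"
    and strict: "\<And>x. x \<in> g ` set ts \<Longrightarrow> (\<exists>p\<in>Q. \<not> dist x q < dist x p) \<Longrightarrow> \<exists>p\<in>Q. dist x p < dist x q"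
  shows False
proof -
  define C where "C = {x. \<forall>p\<in>Q. dist x q < dist x p}"
  obtain t1 t2 t3 t4 t5 t6 t7 t8 where eq: "ts = [t1, t2, t3, t4, t5, t6, t7, t8]"
    using ts(3) by (auto simp: numeral_eq_Suc length_Suc_conv)
  have t: "0 \<le> t1" "t1 \<le> t2" "t2 \<le> t3" "t3 \<le> t4" "t4 \<le> t5" "t5 \<le> t6" "t6 \<le> t7" "t7 \<le> t8" "t8 \<le> 1"
    using ts(1,2) by (auto simp: eq)
  have alt: "g t1 \<in> C \<longleftrightarrow> b" "g t2 \<in> C \<longleftrightarrow> \<not> b" "g t3 \<in> C \<longleftrightarrow> b" "g t4 \<in> C \<longleftrightarrow> \<not> b"
    "g t5 \<in> C \<longleftrightarrow> b" "g t6 \<in> C \<longleftrightarrow> \<not> b" "g t7 \<in> C \<longleftrightarrow> b" "g t8 \<in> C \<longleftrightarrow> \<not> b"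
    using alt unfolding C_def[symmetric] eq list.map alternating.simps by blast+
  have out: "\<exists>p\<in>Q. dist (g x) p < dist (g x) q" if "x \<in> set ts" "g x \<notin> C" for x
    using strict[of "g x"] that unfolding C_def by blast
  have inC: "dist (g x) q < dist (g x) p" if "g x \<in> C" "p \<in> Q" for x p
    using that unfolding C_def by blast
  show False
  proof (cases "interior K = {}")
    case False
    then have g': "simple_path g" "pathfinish g = pathstart g" "path_image g = frontier K"
      using g by (auto simp: ccw_boundary_walk_def)
    have qQ: "q \<in> interior K" "Q \<subseteq> K" using int[OF False] by auto
    show False
    proof (cases b)
      case True
      show False
        by (rule voronoi_cell_loop[OF K qQ g' t]) (use alt True in \<open>auto intro!: inC out simp: eq\<close>)
    next
      case False
      \<comment> \<open>Reversal sends each time \<open>t\<close> to \<open>1 - t\<close>; the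
        sequence now starts with \<open>t8\<close>, whose point is in the cell.\<close>
      let ?h = "reversepath g"
      have h: "?h (1 - x) = g x" for x by (simp add: reversepath_def)
      show False
      proof (rule voronoi_cell_loop[OF K qQ, of ?h "1-t8" "1-t7" "1-t6" "1-t5" "1-t4" "1-t3" "1-t2" "1-t1"])
        show "simple_path ?h" "pathfinish ?h = pathstart ?h" "path_image ?h = frontier K"
          using g' by (auto simp: simple_path_reversepath)
        show "dist (?h x) q < dist (?h x) p"
          if "x \<in> {1 - t8, 1 - t6, 1 - t4, 1 - t2}" "p \<in> Q" for x p
          using that alt False by (auto simp: h intro!: inC)
        show "\<exists>p\<in>Q. dist (?h x) p < dist (?h x) q" if "x \<in> {1 - t7, 1 - t5, 1 - t3, 1 - t1}" for x
          using that alt False by (auto simp: h eq intro!: out)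
      qed (use t in auto)
    qed
  next
    case True
    then obtain a c where gg: "g = linepath a c +++ linepath c a"
      using g by (auto simp: ccw_boundary_walk_def)
    have mid: "g y \<in> C" if "x \<le> y" "y \<le> z" "z \<le> 1/2 \<or> 1/2 \<le> x" "g x \<in> C" "g z \<in> C" for x y z
      using there_and_back_in_segment[OF that(1-3), of a c]
        closed_segment_subset[OF that(4,5) convex_voronoi_cell[of Q q, folded C_def]] unfolding gg by blast
    \<comment> \<open>The second of three cell times lies on one side of the turn; with a
      neighbouring cell time on the same leg, or across to the turn's far leg respectively, it
      encloses a time outside the cell: the split is at \<open>t3\<close> or
      \<open>t4\<close>.\<close>
    show False
    proof (cases b)
      case True
      then show False
        using mid[of t1 t2 t3] mid[of t3 t4 t5] t alt by (cases "t3 \<le> 1/2") auto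
    next
      case False
      then show False
        using mid[of t2 t3 t4] mid[of t4 t5 t6] t alt by (cases "t4 \<le> 1/2") auto
    qed
  qed
qed

lemma alternating_map:
  assumes "\<And>x. x \<in> set zs \<Longrightarrow> f x \<in> B \<longleftrightarrow> x \<in> A"
  shows "alternating B b (map f zs) \<longleftrightarrow> alternating A b zs"
  using assms by (induction zs arbitrary: b) auto

text \<open>If three runs do not suffice, there are \<open>8 = 2 * 3 + 2\<close> sources alternating
  between the cell and its complement, and their boundary times contradict
  \<open>voronoi_cell_boundary_walk\<close>.\<close>

lemma voronoi_cell_consecutive:
  fixes I :: "('s, 't) flamecast"
  assumes fin: "finite (sources I)" "finite (sinks I)"
    and xs: "cyclic_ordering I xs"
    and int: "interior (instance_hull I) \<noteq> {} \<Longrightarrow> q \<in> interior (instance_hull I) \<and> Q \<subseteq> instance_hull I"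
    and A: "A = {s \<in> sources I. \<forall>p\<in>Q. dist (source_pos I s) q < dist (source_pos I s) p}"
    and strict: "\<And>s. s \<in> sources I \<Longrightarrow> s \<notin> A \<Longrightarrow> \<exists>p\<in>Q. dist (source_pos I s) p < dist (source_pos I s) q"
  shows "\<exists>P. partition_on A P \<and> finite P \<and> card P \<le> 3 \<and> (\<forall>B\<in>P. consecutive_in xs B)"
proof (rule ccontr)
  assume no: "\<not> ?thesis"
  obtain g ts where g: "distinct xs" "set xs = sources I" "ccw_boundary_walk g (instance_hull I)"
    "sorted ts" "set ts \<subseteq> {0..1}" "map g ts = map (source_pos I) xs"
    using xs by (auto simp: cyclic_ordering_def)
  have "A \<subseteq> set xs" using A g(2) by auto
  then obtain zs b where zs: "subseq zs xs" "length zs = 8" "alternating A b zs"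
    using cyclic_runs_or_alternating[OF g(1), of A 3] no by auto
  \<comment> \<open>The index set \<open>N\<close> also selects the matching entries of the list of
    times, which stay sorted.\<close>
  obtain N where N: "zs = nths xs N" using zs(1) by (auto simp: subseq_conv_nths)
  define us where "us = nths ts N"
  have us: "map g us = map (source_pos I) zs"
    unfolding us_def N nths_map[symmetric] g(6) ..
  have zsS: "set zs \<subseteq> sources I" unfolding N g(2)[symmetric] by (rule set_nths_subset)
  have hull: "convex (instance_hull I)" "compact (instance_hull I)"
    using fin by (auto simp: instance_hull_def finite_imp_compact_convex_hull)
  show False
  proof (rule voronoi_cell_boundary_walk[OF hull int g(3)])
    show "sorted us" "set us \<subseteq> {0..1}"
      using g(4,5) set_nths_subset[of ts N] by (auto simp: us_def sorted_nths)
    show "length us = 8" using arg_cong[OF us, of length] zs(2) by simp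
    show "alternating {x. \<forall>p\<in>Q. dist x q < dist x p} b (map g us)"
      unfolding us using zs(3) zsS by (subst alternating_map[of _ _ _ A]) (auto simp: A)
    fix x assume x: "x \<in> g ` set us" "\<exists>p\<in>Q. \<not> dist x q < dist x p"
    have "g ` set us = source_pos I ` set zs" using arg_cong[OF us, of set] by simp
    then obtain s where s: "s \<in> set zs" "x = source_pos I s" using x(1) by auto
    then show "\<exists>p\<in>Q. dist x p < dist x q" using strict[of s] x(2) zsS by (auto simp: A)
  qed auto
qed

subsection \<open>Two-level layouts\<close>

text \<open>Paths have at most two edges. A Steiner vertex is neither a leaf nor a root, so it has
  an edge on either side; the lower end must then be a leaf and the upper end a root.\<close>

lemma layout_structure:
  assumes L: "is_layout I L" and t: "sinks I = {t}" and n: "num_layers I = 1"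
  shows "finite (verts L)" "finite (edges L)"
    and "s \<in> sources I \<Longrightarrow> \<exists>w\<in>insert (Sink t) (verts L \<inter> range Steiner). (Source s, w) \<in> edges L"
    and "v \<in> verts L \<inter> range Steiner \<Longrightarrow> (v, Sink t) \<in> edges L"
    and "v \<in> verts L \<inter> range Steiner \<Longrightarrow> \<exists>s\<in>sources I. (Source s, v) \<in> edges L"
proof -
  have fin: "finite (verts L)" and sub: "edges L \<subseteq> verts L \<times> verts L"
    and leaves: "leaves L = Source ` sources I" and roots: "roots L \<subseteq> {Sink t}"
    and inner: "verts L - leaves L - roots L \<subseteq> range Steiner"
    and three: "edges L ^^ Suc (Suc (Suc 0)) = {}"
    using L t n by (auto simp: is_layout_def rooted_forest_def numeral_3_eq_3)
  have path: False if "(a, b) \<in> edges L" "(b, c) \<in> edges L" "(c, d) \<in> edges L" for a b c d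
  proof -
    have "(a, d) \<in> edges L ^^ Suc (Suc (Suc 0))" using that by auto
    then show False using three by blast
  qed
  show "finite (verts L)" by (rule fin)
  show "finite (edges L)" using fin sub by (meson finite_SigmaI finite_subset)
  have parent: "\<exists>w. (u, w) \<in> edges L" if "u \<in> verts L" "u \<noteq> Sink t" for u
    using that roots by (auto simp: roots_def)
  have child: "\<exists>u. (u, w) \<in> edges L" if "w \<in> verts L" "w \<notin> Source ` sources I" for w
    using that leaves by (auto simp: leaves_def children_def)
  show "\<exists>w\<in>insert (Sink t) (verts L \<inter> range Steiner). (Source s, w) \<in> edges L" if "s \<in> sources I"
  proof -
    have "Source s \<in> leaves L" using leaves that by auto
    then have "Source s \<in> verts L" by (simp add: leaves_def)
    then obtain w where w: "(Source s, w) \<in> edges L" using parent by blast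
    then have "w \<in> verts L" "w \<notin> leaves L" using sub by (auto simp: leaves_def children_def)
    then show ?thesis using w inner roots by blast
  qed
  {
    assume v: "v \<in> verts L \<inter> range Steiner"
    obtain w where w: "(v, w) \<in> edges L" using parent[of v] v by auto
    obtain u where u: "(u, v) \<in> edges L" using child[of v] v by auto
    have "\<nexists>x. (w, x) \<in> edges L" "\<nexists>x. (x, u) \<in> edges L" using path u w by blast+
    then have "w \<in> roots L" "u \<in> leaves L"
      using sub u w by (auto simp: roots_def leaves_def children_def)
    then show "(v, Sink t) \<in> edges L" "\<exists>s\<in>sources I. (Source s, v) \<in> edges L"
      using roots leaves u w by auto
  }
qed

text \<open>With exponent \<open>0\<close>, a positive load makes the load factor in the cost equal
  to \<open>1\<close>.\<close>

lemma load_positive: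
  assumes "finite (verts L)" "Source s \<in> verts L" "(Source s, u) \<in> (edges L)\<^sup>*"
  shows "1 \<le> load L u"
proof -
  have "finite (Source -` verts L)" using assms(1) by (intro finite_vimageI) (auto simp: inj_def)
  then have "finite {s. Source s \<in> verts L \<and> (Source s, u) \<in> (edges L)\<^sup>*}"
    by (rule rev_finite_subset) auto
  then have "0 < load L u" unfolding load_def using assms(2,3) by (auto simp: card_gt_0_iff)
  then show ?thesis by simp
qed

text \<open>One edge above each source and one above each vertex of \<open>V\<close> are distinct
  edges of \<open>L\<close>, and all other edges have nonnegative cost. The subset \<open>V\<close>
  accounts for Steiner vertices that a new layout may drop.\<close>

lemma cost_lower_bound:
  fixes L :: "('s, 't) layout"
  assumes L: "is_layout I L" and t: "sinks I = {t}" and n: "num_layers I = 1" and "alpha I = 0"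
    and w: "\<And>s. s \<in> sources I \<Longrightarrow> (Source s, w s) \<in> edges L"
    and V: "V \<subseteq> verts L \<inter> range Steiner" and fin: "finite (sources I)"
  shows "(\<Sum>s\<in>sources I. dist (source_pos I s) (pos L (w s))) +
    (\<Sum>v\<in>V. dist (pos L v) (sink_pos I t)) \<le> cost I L"
proof -
  note st = layout_structure[OF L t n]
  have pos: "pos L (Source s) = source_pos I s" if "s \<in> sources I" for s
    using L that by (simp add: is_layout_def)
  have post: "pos L (Sink t) = sink_pos I t" using L t by (simp add: is_layout_def)
  have sv: "Source s \<in> verts L" if "s \<in> sources I" for s
    using L that by (auto simp: is_layout_def leaves_def)
  let ?E1 = "(\<lambda>s. (Source s, w s)) ` sources I" and ?E2 = "(\<lambda>v. (v, Sink t)) ` V"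
  let ?c = "\<lambda>(u, v). dist (pos L u) (pos L v) * real (load L u) powr alpha I"
  let ?d = "\<lambda>(u, v). dist (pos L u) (pos L v)"
  have finV: "finite V" using V st(1) finite_subset by blast
  have le: "?d e \<le> ?c e" if "e \<in> ?E1 \<union> ?E2" for e
  proof -
    have "\<exists>s\<in>sources I. (Source s, fst e) \<in> (edges L)\<^sup>*"
      using that V st(5)[of "fst e"] by force
    then have "1 \<le> load L (fst e)" using load_positive[OF st(1) sv] by blast
    then show ?thesis using \<open>alpha I = 0\<close> by (auto split: prod.split)
  qed
  have "(\<Sum>s\<in>sources I. dist (source_pos I s) (pos L (w s))) + (\<Sum>v\<in>V. dist (pos L v) (sink_pos I t))
      = sum ?d ?E1 + sum ?d ?E2"
    using pos post by (subst (1 2) sum.reindex) (auto simp: inj_on_def intro!: sum.cong)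
  also have "\<dots> = sum ?d (?E1 \<union> ?E2)"
    using fin finV V by (intro sum.union_disjoint[symmetric]) auto
  also have "\<dots> \<le> sum ?c (?E1 \<union> ?E2)" by (intro sum_mono le)
  also have "\<dots> \<le> sum ?c (edges L)"
  proof (rule sum_mono2[OF st(2)])
    have "?E2 \<subseteq> edges L" using V st(4) by blast
    then show "?E1 \<union> ?E2 \<subseteq> edges L" using w by blast
  qed auto
  finally show ?thesis by (simp add: cost_def)
qed

text \<open>Leaves must be sources, so only vertices that receive a source occur, and the sink is
  absent if \<open>S\<close> is empty. Sources may be assigned to the sink directly; removing
  \<open>Sink t\<close> from the image avoids a loop there.\<close>

definition two_level_layout ::
    "'s set \<Rightarrow> 't \<Rightarrow> ('s \<Rightarrow> ('s, 't) vertex) \<Rightarrow> (('s, 't) vertex \<Rightarrow> real ^ 2) \<Rightarrow> ('s, 't) layout" where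
  "two_level_layout S t f p =
     \<lparr>verts = Source ` S \<union> f ` S \<union> (if S = {} then {} else {Sink t}),
      edges = (\<lambda>s. (Source s, f s)) ` S \<union> (\<lambda>v. (v, Sink t)) ` (f ` S - {Sink t}),
      pos = p\<rparr>"

context
  fixes I :: "('s, 't) flamecast" and t :: 't and f :: "'s \<Rightarrow> ('s, 't) vertex"
    and p :: "('s, 't) vertex \<Rightarrow> real ^ 2" and L :: "('s, 't) layout"
  assumes fin: "finite (sources I)" and sinks: "sinks I = {t}"
    and caps: "capacities I = [\<infinity>, \<infinity>, \<infinity>]" and alpha: "alpha I = 0"
    and f: "f ` sources I \<subseteq> insert (Sink t) (range Steiner)"
    and p_source: "\<And>s. s \<in> sources I \<Longrightarrow> p (Source s) = source_pos I s"
    and p_sink: "p (Sink t) = sink_pos I t"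
    and L_def: "L = two_level_layout (sources I) t f p"
begin

lemma edges_L: "(u, v) \<in> edges L \<longleftrightarrow>
    (\<exists>s\<in>sources I. u = Source s \<and> v = f s) \<or> (u \<in> f ` sources I \<and> u \<noteq> Sink t \<and> v = Sink t)"
  unfolding L_def two_level_layout_def by auto

lemma verts_L: "verts L = Source ` sources I \<union> f ` sources I \<union> (if sources I = {} then {} else {Sink t})"
  unfolding L_def two_level_layout_def by simp

lemma f_not_source: "s \<in> sources I \<Longrightarrow> f s \<noteq> Source x" "s \<in> sources I \<Longrightarrow> Source x \<noteq> f s"
  using f by (auto dest: sym)

lemma two_level_is_layout: "is_layout I L"
proof -
  have fS: "f s = Sink t \<or> (\<exists>n. f s = Steiner n)" if "s \<in> sources I" for s
    using f that by auto
  \<comment> \<open>The rank \<open>0\<close> for sources, \<open>1\<close> for Steiner vertices and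
    \<open>2\<close> for sinks increases along every edge.\<close>
  have "edges L \<subseteq> Wellfounded.measure (\<lambda>v. case v of Source _ \<Rightarrow> 0 | Steiner _ \<Rightarrow> 1 | Sink _ \<Rightarrow> 2)"
    by (auto simp: edges_L) (use fS in force)+
  then have acyc: "acyclic (edges L)" using wf_acyclic wf_subset wf_measure by blast
  have forest: "rooted_forest L"
    unfolding rooted_forest_def
  proof (intro conjI acyc)
    show "finite (verts L)" using fin by (simp add: verts_L)
    show "edges L \<subseteq> verts L \<times> verts L" by (auto simp: edges_L verts_L)
    show "single_valued (edges L)" using f_not_source by (auto simp: single_valued_def edges_L)
  qed
  have layers: "num_layers I = 1" by (simp add: num_layers_def caps)
  have "(a, b) \<notin> edges L ^^ 3" for a b
    using f_not_source by (auto simp: numeral_3_eq_3 edges_L relcomp_unfold)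
  then have empty3: "edges L ^^ 3 = {}" by auto
  have leaves: "leaves L = Source ` sources I"
  proof -
    have "\<exists>u. (u, v) \<in> edges L" if v: "v \<in> verts L" "v \<notin> Source ` sources I" for v
    proof (cases "v \<in> f ` sources I")
      case True
      then show ?thesis by (auto simp: edges_L)
    next
      case False
      then obtain s where "v = Sink t" "s \<in> sources I" using v by (auto simp: verts_L split: if_splits)
      moreover from this have "f s \<noteq> Sink t" using False by (metis imageI)
      ultimately have "(f s, v) \<in> edges L" by (auto simp: edges_L)
      then show ?thesis by blast
    qed
    moreover have "(u, Source s) \<notin> edges L" for u s using f_not_source by (auto simp: edges_L)
    moreover have "Source ` sources I \<subseteq> verts L" by (auto simp: verts_L)
    ultimately show ?thesis unfolding leaves_def children_def by blast
  qed
  have roots: "roots L \<subseteq> {Sink t}"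
    by (auto simp: roots_def verts_L edges_L split: if_splits)
  have steiner: "verts L - leaves L - roots L \<subseteq> range Steiner"
  proof
    fix v assume v: "v \<in> verts L - leaves L - roots L"
    have "v \<noteq> Sink t"
    proof
      assume "v = Sink t"
      then show False using v f_not_source by (auto simp: roots_def edges_L)
    qed
    then show "v \<in> range Steiner" using v leaves f by (auto simp: verts_L split: if_splits)
  qed
  \<comment> \<open>This bound keeps the height within the list of three capacities.\<close>
  have height: "vertex_height L v \<le> 2" for v
  proof -
    have bound: "n \<le> 2" if "\<exists>u. (u, v) \<in> edges L ^^ n" for n
    proof (rule ccontr)
      assume "\<not> n \<le> 2"
      then obtain m where "n = 3 + m" by (metis add.commute not_less_eq_eq Suc_1 eval_nat_numeral(3) le_Suc_ex)
      then show False using that empty3 by (simp add: relpow_add)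
    qed
    have "\<exists>u. (u, v) \<in> edges L ^^ 0" by simp
    then have "\<exists>u. (u, v) \<in> edges L ^^ vertex_height L v"
      unfolding vertex_height_def using bound by (rule GreatestI_nat)
    then show ?thesis by (rule bound)
  qed
  have "capacities I ! vertex_height L v = \<infinity>" for v
    using height[of v] by (auto simp: caps numeral_2_eq_2 le_Suc_eq nth_Cons')
  then show ?thesis
    unfolding is_layout_def
    using forest empty3 leaves roots steiner p_source p_sink sinks layers
    by (auto simp: L_def two_level_layout_def numeral_3_eq_3)
qed

lemma two_level_cost:
  "cost I L \<le> (\<Sum>s\<in>sources I. dist (source_pos I s) (p (f s))) +
     (\<Sum>v\<in>f ` sources I - {Sink t}. dist (p v) (sink_pos I t))"
proof -
  let ?V = "f ` sources I - {Sink t}"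
  let ?E1 = "(\<lambda>s. (Source s, f s)) ` sources I" and ?E2 = "(\<lambda>v. (v, Sink t)) ` ?V"
  let ?d = "\<lambda>(u, v). dist (p u) (p v)"
  have E: "edges L = ?E1 \<union> ?E2" by (simp add: L_def two_level_layout_def)
  have "cost I L \<le> sum ?d (edges L)"
  proof -
    have "pos L = p" by (simp add: L_def two_level_layout_def)
    \<comment> \<open>\<open>real n powr 0\<close> is \<open>0\<close> for \<open>n = 0\<close> and
      \<open>1\<close> otherwise.\<close>
    moreover have "d * real n powr 0 \<le> d" if "0 \<le> d" for d :: real and n :: nat
      using that by simp
    ultimately show ?thesis unfolding cost_def alpha by (intro sum_mono) (auto split: prod.split)
  qed
  also have "\<dots> = sum ?d ?E1 + sum ?d ?E2"
    unfolding E using fin f_not_source by (intro sum.union_disjoint) auto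
  also have "\<dots> = (\<Sum>s\<in>sources I. dist (source_pos I s) (p (f s))) + (\<Sum>v\<in>?V. dist (p v) (sink_pos I t))"
    using p_source p_sink by (subst (1 2) sum.reindex) (auto simp: inj_on_def intro!: sum.cong)
  finally show ?thesis .
qed

lemma two_level_children:
  assumes "v \<in> range Steiner"
  shows "children L v = Source ` {s \<in> sources I. f s = v}"
  using assms by (auto simp: children_def edges_L)

end

section \<open>Nearest-site assignment under perturbation\<close>

text \<open>Finitely many points and sites leave a least positive gap between distances. Moving two
  sites by less than half of it each cannot reverse a strict inequality between their distances to a
  point of \<open>X\<close>.\<close>

lemma stable_nearest_radius:
  fixes a :: "'z \<Rightarrow> real ^ 2" and X :: "(real ^ 2) set"
  assumes "finite Z" "finite X"
  obtains \<epsilon> where "0 < \<epsilon>"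
    "\<And>b x z z'. x \<in> X \<Longrightarrow> z \<in> Z \<Longrightarrow> z' \<in> Z \<Longrightarrow> dist (b z) (a z) < \<epsilon> \<Longrightarrow> dist (b z') (a z') < \<epsilon> \<Longrightarrow>
       dist x (b z) < dist x (b z') \<Longrightarrow> dist x (a z) \<le> dist x (a z')"
proof -
  define D where "D = {d. 0 < d \<and> (\<exists>x\<in>X. \<exists>z\<in>Z. \<exists>z'\<in>Z. d = dist x (a z) - dist x (a z'))}"
  have "D \<subseteq> (\<lambda>(x, z, z'). dist x (a z) - dist x (a z')) ` (X \<times> Z \<times> Z)"
    by (force simp: D_def)
  then have "finite D" using assms finite_subset by blast
  \<comment> \<open>The \<open>1\<close> keeps the minimum defined if there is no positive
    gap.\<close>
  define \<epsilon> where "\<epsilon> = Min (insert 1 D) / 2"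
  have pos: "0 < \<epsilon>" using \<open>finite D\<close> by (auto simp: \<epsilon>_def D_def)
  have "dist x (a z) \<le> dist x (a z')"
    if h: "x \<in> X" "z \<in> Z" "z' \<in> Z" "dist (b z) (a z) < \<epsilon>" "dist (b z') (a z') < \<epsilon>"
      "dist x (b z) < dist x (b z')" for b x z z'
  proof (rule ccontr)
    assume "\<not> ?thesis"
    then have "dist x (a z) - dist x (a z') \<in> D" using h by (auto simp: D_def)
    then have "2 * \<epsilon> \<le> dist x (a z) - dist x (a z')" using \<open>finite D\<close> by (simp add: \<epsilon>_def)
    moreover have "dist x (a z) \<le> dist x (b z) + dist (b z) (a z)" by (rule dist_triangle)
    moreover have "dist x (b z') \<le> dist x (a z') + dist (b z') (a z')"
      using dist_triangle[of x "b z'" "a z'"] by (simp add: dist_commute)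
    ultimately show False using h(4-6) by linarith
  qed
  then show ?thesis using that pos by blast
qed

text \<open>Each source takes its unique nearest perturbed site, so the assigned sets are open
  Voronoi cells without ties, and the perturbation is small enough that the choice is also nearest
  for \<open>a\<close>. Since \<open>f\<close> is chosen before \<open>xs\<close>, one assignment
  serves all cyclic orderings.\<close>

lemma three_consecutive_assignment:
  fixes I :: "('s, 't) flamecast" and a :: "'z \<Rightarrow> real ^ 2"
  assumes fin: "finite (sources I)" "finite (sinks I)" "finite Z" "Z \<noteq> {}"
    and aK: "\<And>z. z \<in> Z \<Longrightarrow> a z \<in> instance_hull I"
  shows "\<exists>f. f ` sources I \<subseteq> Z \<and>
    (\<forall>s\<in>sources I. \<forall>z\<in>Z. dist (source_pos I s) (a (f s)) \<le> dist (source_pos I s) (a z)) \<and>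
    (\<forall>xs. cyclic_ordering I xs \<longrightarrow> (\<forall>z\<in>Z. \<exists>P. partition_on {s \<in> sources I. f s = z} P \<and>
       finite P \<and> card P \<le> 3 \<and> (\<forall>B\<in>P. consecutive_in xs B)))"
proof -
  let ?K = "instance_hull I" and ?S = "sources I" and ?pos = "source_pos I"
  have K: "convex ?K" "closed ?K"
    using fin by (auto simp: instance_hull_def finite_imp_compact_convex_hull compact_imp_closed)
  obtain \<epsilon> where \<epsilon>: "0 < \<epsilon>"
    "\<And>b x z z'. x \<in> ?pos ` ?S \<Longrightarrow> z \<in> Z \<Longrightarrow> z' \<in> Z \<Longrightarrow> dist (b z) (a z) < \<epsilon> \<Longrightarrow> dist (b z') (a z') < \<epsilon> \<Longrightarrow>
       dist x (b z) < dist x (b z') \<Longrightarrow> dist x (a z) \<le> dist x (a z')"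
    using stable_nearest_radius[OF fin(3) finite_imageI[OF fin(1), of ?pos], where a = a] by metis
  \<comment> \<open>If the hull has interior points, the perturbed sites must lie among them, as
    \<open>voronoi_cell_consecutive\<close> demands.\<close>
  define N where "N z = (if interior ?K = {} then ball (a z) \<epsilon> else ball (a z) \<epsilon> \<inter> interior ?K)" for z
  have N: "open (N z)" "N z \<noteq> {}" if "z \<in> Z" for z
  proof -
    show "open (N z)" by (auto simp: N_def)
    show "N z \<noteq> {}"
    proof (cases "interior ?K = {}")
      case True
      then show ?thesis using \<epsilon>(1) by (auto simp: N_def)
    next
      case False
      \<comment> \<open>A closed convex set with interior points is the closure of its interior, so
        sites on the boundary can also be moved inside by less than
        \<open>\<epsilon>\<close>.\<close>
      have "a z \<in> closure (interior ?K)"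
        using convex_closure_interior[OF K(1) False] aK[OF that] K(2) by simp
      then obtain y where "y \<in> interior ?K" "dist y (a z) < \<epsilon>" using \<epsilon>(1) closure_approachable by blast
      then have "y \<in> N z" using False by (simp add: N_def dist_commute)
      then show ?thesis by blast
    qed
  qed
  obtain \<sigma> where \<sigma>: "\<And>z. z \<in> Z \<Longrightarrow> \<sigma> z \<in> N z"
    and gen: "\<And>z z' x. z \<in> Z \<Longrightarrow> z' \<in> Z \<Longrightarrow> x \<in> ?pos ` ?S \<Longrightarrow> z \<noteq> z' \<Longrightarrow> dist x (\<sigma> z) \<noteq> dist x (\<sigma> z')"
    using generic_points_exist[OF fin(3) finite_imageI[OF fin(1), of ?pos], where N = N] N by metis
  have near: "dist (\<sigma> z) (a z) < \<epsilon>" if "z \<in> Z" for z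
    using \<sigma>[OF that] by (auto simp: N_def dist_commute split: if_splits)
  define f where "f s = arg_min_on (\<lambda>z. dist (?pos s) (\<sigma> z)) Z" for s
  have fZ: "f s \<in> Z" for s unfolding f_def using fin(3,4) by (rule arg_min_if_finite)
  have fmin: "dist (?pos s) (\<sigma> (f s)) < dist (?pos s) (\<sigma> z)" if "s \<in> ?S" "z \<in> Z" "z \<noteq> f s" for s z
  proof -
    have "dist (?pos s) (\<sigma> (f s)) \<le> dist (?pos s) (\<sigma> z)"
      unfolding f_def using fin(3,4) that(2) by (rule arg_min_least)
    then show ?thesis using gen[of "f s" z "?pos s"] fZ that by force
  qed
  show ?thesis
  proof (intro exI[of _ f] conjI ballI allI impI)
    show "f ` ?S \<subseteq> Z" using fZ by auto
    show "dist (?pos s) (a (f s)) \<le> dist (?pos s) (a z)" if "s \<in> ?S" "z \<in> Z" for s z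
      using \<epsilon>(2)[of "?pos s" "f s" z \<sigma>] near fZ fmin[OF that] that by (cases "z = f s") auto
    fix xs z assume xs: "cyclic_ordering I xs" and z: "z \<in> Z"
    let ?Q = "\<sigma> ` (Z - {z})"
    have A: "{s \<in> ?S. f s = z} = {s \<in> ?S. \<forall>p\<in>?Q. dist (?pos s) (\<sigma> z) < dist (?pos s) p}"
    proof (rule Collect_cong, rule conj_cong[OF refl])
      fix s assume s: "s \<in> ?S"
      show "f s = z \<longleftrightarrow> (\<forall>p\<in>?Q. dist (?pos s) (\<sigma> z) < dist (?pos s) p)"
      proof
        assume "f s = z"
        then show "\<forall>p\<in>?Q. dist (?pos s) (\<sigma> z) < dist (?pos s) p" using fmin[OF s] by auto
      next
        assume h: "\<forall>p\<in>?Q. dist (?pos s) (\<sigma> z) < dist (?pos s) p"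
        show "f s = z"
        proof (rule ccontr)
          assume "f s \<noteq> z"
          then have "dist (?pos s) (\<sigma> z) < dist (?pos s) (\<sigma> (f s))" using h fZ[of s] by auto
          then show False using fmin[OF s z] \<open>f s \<noteq> z\<close> by auto
        qed
      qed
    qed
    show "\<exists>P. partition_on {s \<in> ?S. f s = z} P \<and> finite P \<and> card P \<le> 3 \<and> (\<forall>B\<in>P. consecutive_in xs B)"
    proof (rule voronoi_cell_consecutive[OF fin(1,2) xs _ A])
      show "\<sigma> z \<in> interior ?K \<and> ?Q \<subseteq> ?K" if "interior ?K \<noteq> {}"
        using \<sigma> z that interior_subset[of ?K] by (auto simp: N_def)
      show "\<exists>p\<in>?Q. dist (?pos s) p < dist (?pos s) (\<sigma> z)" if "s \<in> ?S" "s \<notin> {s \<in> ?S. f s = z}" for s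
        using fmin[of s z] that z fZ[of s] by auto
    qed
  qed
qed

section \<open>Projection onto the hull and comparison of costs\<close>

theorem lemma30:
  fixes I :: "('s, 't) flamecast" and L :: "('s, 't) layout" and t :: 't
  assumes "is_instance I"
    and "sinks I = {t}"
    and "capacities I = [\<infinity>, \<infinity>, \<infinity>]"
    and "alpha I = 0"
    and "convex_instance I"
    and "is_layout I L"
  shows "\<exists>L'. is_layout I L' \<and> cost I L' \<le> cost I L \<and>
           (\<forall>xs. cyclic_ordering I xs \<longrightarrow> k_consecutive 3 xs L')"
proof -
  have fin: "finite (sources I)" "finite (sinks I)" using assms(1) by (auto simp: is_instance_def)
  have layers: "num_layers I = 1" using assms(3) by (simp add: num_layers_def)
  note st = layout_structure[OF assms(6,2) layers]
  let ?K = "instance_hull I"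
  have K: "convex ?K" "closed ?K" and t: "sink_pos I t \<in> ?K"
    and sK: "\<And>s. s \<in> sources I \<Longrightarrow> source_pos I s \<in> ?K"
    using fin assms(2)
    by (auto simp: instance_hull_def finite_imp_compact_convex_hull compact_imp_closed hull_inc)
  then have ne: "?K \<noteq> {}" by auto
  define V where "V = verts L \<inter> range Steiner"
  define p where "p v = (case v of Source s \<Rightarrow> source_pos I s | Sink _ \<Rightarrow> sink_pos I t
    | Steiner _ \<Rightarrow> closest_point ?K (pos L v))" for v
  have pK: "p v \<in> ?K" if "v \<in> insert (Sink t) V" for v
    using that t closest_point_in_set[OF K(2) ne] by (auto simp: p_def V_def)
  have post: "pos L (Sink t) = sink_pos I t" using assms(2,6) by (simp add: is_layout_def)
  \<comment> \<open>The closest-point projection is 1-Lipschitz and fixes the points of the hull;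
    the sink stays in place.\<close>
  have contract: "dist x (p v) \<le> dist x (pos L v)" if "x \<in> ?K" "v \<in> insert (Sink t) V" for x v
    using closest_point_lipschitz[OF K ne, of x "pos L v"] closest_point_self[OF that(1)] that(2) post
    by (auto simp: p_def V_def)
  have finV: "finite (insert (Sink t) V)" using st(1) by (simp add: V_def)
  obtain f where F: "f ` sources I \<subseteq> insert (Sink t) V \<and>
    (\<forall>s\<in>sources I. \<forall>v\<in>insert (Sink t) V. dist (source_pos I s) (p (f s)) \<le> dist (source_pos I s) (p v)) \<and>
    (\<forall>xs. cyclic_ordering I xs \<longrightarrow> (\<forall>v\<in>insert (Sink t) V. \<exists>P. partition_on {s \<in> sources I. f s = v} P \<and>
       finite P \<and> card P \<le> 3 \<and> (\<forall>B\<in>P. consecutive_in xs B)))"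
    using three_consecutive_assignment[OF fin finV insert_not_empty pK] by (rule exE)
  note f = F[THEN conjunct1] and fmin = F[THEN conjunct2, THEN conjunct1, rule_format]
    and consec = F[THEN conjunct2, THEN conjunct2, rule_format]
  define L' where "L' = two_level_layout (sources I) t f p"
  have f': "f ` sources I \<subseteq> insert (Sink t) (range Steiner)" using f by (auto simp: V_def)
  have p: "\<And>s. s \<in> sources I \<Longrightarrow> p (Source s) = source_pos I s" "p (Sink t) = sink_pos I t"
    by (simp_all add: p_def)
  note two_level = fin(1) assms(2-4) f' p L'_def
  obtain w where w: "\<And>s. s \<in> sources I \<Longrightarrow> w s \<in> insert (Sink t) V \<and> (Source s, w s) \<in> edges L"
    using st(3) unfolding V_def by metis
  have "cost I L' \<le> (\<Sum>s\<in>sources I. dist (source_pos I s) (p (f s))) +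
     (\<Sum>v\<in>f ` sources I - {Sink t}. dist (p v) (sink_pos I t))"
    by (rule two_level_cost[OF two_level])
  \<comment> \<open>The old parent \<open>w s\<close> is among the candidate sites, so the nearest
    projected site is no farther from \<open>s\<close>; projection does not lengthen the edges to
    the sink.\<close>
  also have "\<dots> \<le> (\<Sum>s\<in>sources I. dist (source_pos I s) (pos L (w s))) +
     (\<Sum>v\<in>f ` sources I - {Sink t}. dist (pos L v) (sink_pos I t))"
  proof (intro add_mono sum_mono)
    show "dist (source_pos I s) (p (f s)) \<le> dist (source_pos I s) (pos L (w s))" if "s \<in> sources I" for s
      using fmin[OF that, of "w s"] contract[OF sK[OF that], of "w s"] w[OF that] by linarith
    show "dist (p v) (sink_pos I t) \<le> dist (pos L v) (sink_pos I t)" if "v \<in> f ` sources I - {Sink t}" for v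
      using contract[OF t, of v] that f by (auto simp: dist_commute)
  qed
  also have "\<dots> \<le> cost I L"
    using w f V_def by (intro cost_lower_bound[OF assms(6,2) layers assms(4) _ _ fin(1)]) auto
  finally have cost: "cost I L' \<le> cost I L" .
  have "k_consecutive 3 xs L'" if xs: "cyclic_ordering I xs" for xs
    unfolding k_consecutive_def k_consecutive_vertex_def
  proof
    fix v assume v: "v \<in> verts L' \<inter> range Steiner"
    let ?A = "{s \<in> sources I. f s = v}"
    have "v \<in> insert (Sink t) V"
      using v f by (auto simp: verts_L[OF two_level] split: if_splits)
    then obtain P where P: "partition_on ?A P" "finite P" "card P \<le> 3" "\<forall>B\<in>P. consecutive_in xs B"
      using consec[OF xs] by blast
    \<comment> \<open>The form of \<open>?P\<close> is that of
      \<open>partition_on_inj_image\<close>; taking images and removing the empty set cannot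
      increase the number of blocks.\<close>
    let ?P = "(`) Source ` P - {{}}"
    have "partition_on (children L' v) ?P"
      using partition_on_inj_image[OF P(1), of Source] two_level_children[OF two_level, of v] v
      by (simp add: inj_on_def)
    moreover have "card ?P \<le> 3"
      using card_mono[OF finite_imageI[OF P(2)] Diff_subset]
        card_image_le[OF P(2), of "(`) Source"] P(3) by (meson order_trans)
    ultimately show "\<exists>P. partition_on (children L' v) P \<and> finite P \<and> card P \<le> 3 \<and>
        (\<forall>B\<in>P. \<exists>A. B = Source ` A \<and> consecutive_in xs A)"
      using P(2,4) by (intro exI[of _ ?P]) auto
  qed
  then show ?thesis using two_level_is_layout[OF two_level] cost by blast
qed

end
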